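(* Let $M$ be an integer, $N\ge1$ an integer and $Q\ge 1$ real. Let $(\mathcal{K}_q)_{q\le Q}$ be a consistent multiplicative sequence that satisfies the Johnsen-Gallagher condition. Let $(u_n)_{M<n\le M+N}$ be a sequence of non-negative real numbers having support on $(\mathcal{K}_q)_{q\le Q}$. Then $$\Bigl|\sum_{M<n\le M+N}u_n\Bigr|^2\le \frac{1}{L(Q)}\sum_{M<n\le M+N}u_n^2,\qquad L(Q)=\sum_{q\le Q}\frac{g(q)}{N+\mathfrak{c}\,q(q+Q)},$$ where the function $g$ and the constant $\mathfrak{c}=0.898678\cdots$ are defined in the context.
   Context: For every positive integer $q\le Q$, $\mathcal{K}_q$ is a non-empty subset of $\mathbb{Z}/q\mathbb{Z}$ (so $\mathcal{K}_1=\mathbb{Z}/1\mathbb{Z}$). The sequence $(\mathcal{K}_q)_{q\le Q}$ is multiplicative if, whenever $q=p_1^{e_1}\cdots p_r^{e_r}$ with distinct primes $p_i$, the set $\mathcal{K}_q$ corresponds to $\prod_{i}\mathcal{K}_{p_i^{e_i}}$ under the Chinese Remainder isomorphism $\mathbb{Z}/q\mathbb{Z}\to\prod_i\mathbb{Z}/p_i^{e_i}\mathbb{Z}$. It is consistent if, whenever $d\mid q$, the image of $\mathcal{K}_q$ under reduction modulo $d$ is $\mathcal{K}_d$. It satisfies the Johnsen-Gallagher condition if for all $q\le Q$, all $d\mid q$ and all $y\in\mathcal{K}_d$, one has $\#\{x\in\mathcal{K}_q: x\equiv y \bmod d\}=|\mathcal{K}_q|/|\mathcal{K}_d|$. A sequence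 $(u_n)$ has support on $(\mathcal{K}_q)_{q\le Q}$ if, whenever $u_n\ne0$, the class of $n$ modulo $q$ belongs to $\mathcal{K}_q$ for every $q\le Q$. The function $g$ is $$g(q)=\prod_{p^\alpha\|q}\Bigl(\frac{p^\alpha}{|\mathcal{K}_{p^\alpha}|}-\frac{p^{\alpha-1}}{|\mathcal{K}_{p^{\alpha-1}}|}\Bigr).$$ The constant $\mathfrak{c}$ is $$\mathfrak{c}=\frac43+\frac{2}{\pi^2}\int_0^1\hat J(v)\hat J'(v)\frac{dv}{v}=0.898678\cdots,$$ where $\hat J(0)=1$, $\hat J(t)=\pi t(1-|t|)\cot(\pi t)+|t|$ for $0<|t|<1$, and $\hat J(t)=0$ for $|t|\ge1$. *)

theory Defs
  imports "HOL-Analysis.Analysis" "HOL-Number_Theory.Cong"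
begin

text \<open>
  The classes of \<open>\<int>/q\<int>\<close> are represented by their least non-negative residues, so a subset of
  \<open>\<int>/q\<int>\<close> is a set of integers contained in \<open>{0..<int q}\<close>, and the class of an integer \<open>n\<close> is
  \<open>n mod int q\<close>.  A sequence \<open>(K q)\<close> with \<open>q \<le> Q\<close> is a function on \<open>nat\<close> of which
  only the values at \<open>1 \<le> q \<le> Q\<close> are relevant.
\<close>

definition moduli :: "real \<Rightarrow> nat set" where
  "moduli Q = {q. 1 \<le> q \<and> real q \<le> Q}"

definition residue_sequence :: "real \<Rightarrow> (nat \<Rightarrow> int set) \<Rightarrow> bool" where
  "residue_sequence Q K \<longleftrightarrow> (\<forall>q \<in> moduli Q. K q \<noteq> {} \<and> K q \<subseteq> {0..<int q})"

text \<open>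
  The Chinese Remainder isomorphism \<open>\<int>/q\<int> \<rightarrow> \<Prod>\<^sub>i \<int>/p\<^sub>i\<^bsup>e\<^sub>i\<^esup>\<int>\<close>; an element of the product is an
  extensional function on the set of prime factors of \<open>q\<close>.
\<close>

definition crt_map :: "nat \<Rightarrow> int \<Rightarrow> nat \<Rightarrow> int" where
  "crt_map q x = (\<lambda>p \<in> prime_factors q. x mod int (p ^ multiplicity p q))"

definition multiplicative_sequence :: "real \<Rightarrow> (nat \<Rightarrow> int set) \<Rightarrow> bool" where
  "multiplicative_sequence Q K \<longleftrightarrow>
     (\<forall>q \<in> moduli Q. crt_map q ` K q = (\<Pi>\<^sub>E p \<in> prime_factors q. K (p ^ multiplicity p q)))"

definition consistent_sequence :: "real \<Rightarrow> (nat \<Rightarrow> int set) \<Rightarrow> bool" where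
  "consistent_sequence Q K \<longleftrightarrow>
     (\<forall>q \<in> moduli Q. \<forall>d. d dvd q \<longrightarrow> (\<lambda>x. x mod int d) ` K q = K d)"

definition johnsen_gallagher :: "real \<Rightarrow> (nat \<Rightarrow> int set) \<Rightarrow> bool" where
  "johnsen_gallagher Q K \<longleftrightarrow>
     (\<forall>q \<in> moduli Q. \<forall>d. d dvd q \<longrightarrow> (\<forall>y \<in> K d.
        real (card {x \<in> K q. [x = y] (mod int d)}) = real (card (K q)) / real (card (K d))))"

definition has_support :: "int \<Rightarrow> nat \<Rightarrow> (int \<Rightarrow> real) \<Rightarrow> real \<Rightarrow> (nat \<Rightarrow> int set) \<Rightarrow> bool" where
  "has_support M N u Q K \<longleftrightarrow>
     (\<forall>n \<in> {M<..M + int N}. u n \<noteq> 0 \<longrightarrow> (\<forall>q \<in> moduli Q. n mod int q \<in> K q))"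

definition g_fun :: "(nat \<Rightarrow> int set) \<Rightarrow> nat \<Rightarrow> real" where
  "g_fun K q = (\<Prod>p \<in> prime_factors q.
     real (p ^ multiplicity p q) / real (card (K (p ^ multiplicity p q)))
     - real (p ^ (multiplicity p q - 1)) / real (card (K (p ^ (multiplicity p q - 1)))))"

definition J_hat :: "real \<Rightarrow> real" where
  "J_hat t =
     (if t = 0 then 1
      else if \<bar>t\<bar> < 1 then pi * t * (1 - \<bar>t\<bar>) * cot (pi * t) + \<bar>t\<bar>
      else 0)"

text \<open>
  The integrand below extends continuously to \<open>[0, 1]\<close>: both \<open>J_hat\<close> and its derivative
  vanish at \<open>1\<close>, and the derivative is \<open>O(v)\<close> at \<open>0\<close>.
  Numerically the constant is \<open>0.898678...\<close>.
\<close>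

definition c_const :: real where
  "c_const = 4 / 3 + 2 / pi\<^sup>2 * integral {0..1} (\<lambda>v. J_hat v * deriv J_hat v / v)"

definition L_fun :: "(nat \<Rightarrow> int set) \<Rightarrow> nat \<Rightarrow> real \<Rightarrow> real" where
  "L_fun K N Q = (\<Sum>q \<in> moduli Q. g_fun K q / (real N + c_const * real q * (real q + Q)))"

end

theory Submission
  imports Defs "HOL-Probability.Sinc_Integral" "HOL-Real_Asymp.Real_Asymp"
begin

text \<open>
  Write \<open>e(x)\<close> for \<open>additive_char x\<close>.  The arcs \<open>\<bar>t - a/q\<bar> \<le> 1/(q(q+Q))\<close> around the reduced fractions
  with \<open>q \<le> Q\<close> do not overlap modulo 1, so \<open>\<Sum> u\<^sub>n\<^sup>2 = \<integral>|F|\<^sup>2\<close> with \<open>F(t) = \<Sum> u\<^sub>n e(nt)\<close> is at least the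
  sum of the integrals over the arcs.  On the arcs of denominator \<open>q\<close> the Cauchy-Schwarz inequality
  against translates of one test function \<open>\<phi>\<^sub>q\<close> bounds \<open>\<integral>|F|\<^sup>2\<close> from below by
  \<open>|\<Sum> u\<^sub>n A\<^sub>q(n) e(na/q)|\<^sup>2 / \<parallel>\<phi>\<^sub>q\<parallel>\<^sup>2\<close>, where \<open>A\<^sub>q\<close> is the Fourier transform of \<open>\<phi>\<^sub>q\<close>.  The sequence
  \<open>u\<^sub>n A\<^sub>q(n)\<close> has the same support as \<open>u\<close>, so the Johnsen-Gallagher condition bounds the sum over \<open>a\<close>
  from below by \<open>g(q) |\<Sum> u\<^sub>n A\<^sub>q(n)|\<^sup>2\<close>, and this is at least \<open>g(q) |\<Sum> u\<^sub>n|\<^sup>2\<close> if \<open>A\<^sub>q \<ge> 1\<close> on the interval.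

  For \<open>A\<^sub>q\<close> one takes the Beurling-Selberg majorant of the interval built from Vaaler's function,
  whose Fourier transform involves \<open>J_hat\<close>; its square norm is at most \<open>N + c_const * q(q+Q)\<close>.
\<close>

section \<open>Riemann-Lebesgue lemma and sine integral\<close>

text \<open>As \<open>g\<close> is merely continuous, it is replaced by a polynomial within
  \<open>e / 2\<close> (Stone-Weierstrass); for the polynomial one integration by parts gains a
  factor \<open>1 / \<omega>\<close>. The phase \<open>\<theta>\<close> makes the cosine version a
  special case.\<close>

lemma Riemann_Lebesgue_sin:
  fixes g :: "real \<Rightarrow> real"
  assumes g: "continuous_on {0..1} g"
  shows "((\<lambda>\<omega>. integral {0..1} (\<lambda>v. g v * sin (\<omega> * v + \<theta>))) \<longlongrightarrow> 0) at_top"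
proof (rule tendstoI)
  fix e :: real assume "e > 0"
  obtain p where p: "real_polynomial_function p" "\<And>v. v \<in> {0..1} \<Longrightarrow> \<bar>g v - p v\<bar> < e / 2"
    using Stone_Weierstrass_real_polynomial_function[of "{0..1::real}" g "e/2"] g \<open>e > 0\<close>
    by (metis compact_Icc half_gt_zero_iff)
  obtain p' where p': "polynomial_function p'" "\<And>v. (p has_vector_derivative p' v) (at v)"
    using has_vector_derivative_polynomial_function[of p] p(1) real_polynomial_function_eq by metis
  have cp: "continuous_on {0..1} p" "continuous_on {0..1} p'"
    using p(1) p'(1) continuous_on_polymonial_function real_polynomial_function_eq by blast+
  have "bounded (p ` {0..1})"
    using cp by (intro compact_imp_bounded compact_continuous_image) auto
  then obtain B where B: "\<And>v. v \<in> {0..1} \<Longrightarrow> \<bar>p v\<bar> \<le> B"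
    unfolding bounded_iff real_norm_def by blast
  have "bounded (p' ` {0..1})"
    using cp by (intro compact_imp_bounded compact_continuous_image) auto
  then obtain B' where B': "\<And>v. v \<in> {0..1} \<Longrightarrow> \<bar>p' v\<bar> \<le> B'"
    unfolding bounded_iff real_norm_def by blast
  have bound: "\<bar>integral {0..1} (\<lambda>v. g v * sin (\<omega> * v + \<theta>))\<bar> \<le> e/2 + (2 * B + B') / \<omega>"
    if "\<omega> > 0" for \<omega>
  proof -
    \<comment> \<open>Integration by parts: this primitive produces the wanted integrand plus a term
      in \<open>p'\<close>, which \<open>I\<close> adds back.\<close>
    have FTC: "((\<lambda>v. - p' v * cos (\<omega> * v + \<theta>) / \<omega> + p v * sin (\<omega> * v + \<theta>)) has_integral
            (- p 1 * cos (\<omega> * 1 + \<theta>) / \<omega>) - (- p 0 * cos (\<omega> * 0 + \<theta>) / \<omega>)) {0..1}"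
    proof (rule fundamental_theorem_of_calculus)
      fix v :: real
      have "(p has_real_derivative p' v) (at v within {0..1})"
        using p'(2)[of v] by (simp add: has_real_derivative_iff_has_vector_derivative has_vector_derivative_at_within)
      then show "((\<lambda>v. - p v * cos (\<omega> * v + \<theta>) / \<omega>) has_vector_derivative
              - p' v * cos (\<omega> * v + \<theta>) / \<omega> + p v * sin (\<omega> * v + \<theta>)) (at v within {0..1})"
        unfolding has_real_derivative_iff_has_vector_derivative[symmetric]
        using that by (auto intro!: derivative_eq_intros simp: field_simps)
    qed simp
    have I: "((\<lambda>v. p' v * cos (\<omega> * v + \<theta>) / \<omega>) has_integral
        integral {0..1} (\<lambda>v. p' v * cos (\<omega> * v + \<theta>) / \<omega>)) {0..1}"
      using cp that by (intro integrable_integral integrable_continuous_real continuous_intros) auto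
    have hp: "((\<lambda>v. p v * sin (\<omega> * v + \<theta>)) has_integral
       (- p 1 * cos (\<omega> * 1 + \<theta>) / \<omega>) - (- p 0 * cos (\<omega> * 0 + \<theta>) / \<omega>)
       + integral {0..1} (\<lambda>v. p' v * cos (\<omega> * v + \<theta>) / \<omega>)) {0..1}"
      using has_integral_add[OF FTC I] by simp
    have tri: "\<bar>a - b + c\<bar> \<le> (2 * B + B') / \<omega>"
      if "\<bar>a\<bar> \<le> B / \<omega>" "\<bar>b\<bar> \<le> B / \<omega>" "\<bar>c\<bar> \<le> B' / \<omega>" for a b c :: real
      using that by (simp add: add_divide_distrib)
    have b1: "\<bar>x * cos y\<bar> \<le> \<bar>x\<bar>" "\<bar>x * sin y\<bar> \<le> \<bar>x\<bar>" for x y :: real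
      by (simp_all add: abs_mult mult_left_le)
    have "\<bar>integral {0..1} (\<lambda>v. p' v * cos (\<omega> * v + \<theta>) / \<omega>)\<bar> \<le> B' / \<omega> * (1 - 0)"
      unfolding real_norm_def[symmetric] 
    proof (rule integral_bound)
      show "continuous_on {0..1} (\<lambda>v. p' v * cos (\<omega> * v + \<theta>) / \<omega>)"
        using cp that by (intro continuous_intros) auto
      show "norm (p' v * cos (\<omega> * v + \<theta>) / \<omega>) \<le> B' / \<omega>" if "v \<in> {0..1}" for v
        using B'[OF that] b1[of "p' v" "\<omega> * v + \<theta>"] \<open>\<omega> > 0\<close> by (auto intro!: divide_right_mono)
    qed auto
    moreover have "\<bar>- p 1 * cos (\<omega> * 1 + \<theta>) / \<omega>\<bar> \<le> B / \<omega>" "\<bar>- p 0 * cos (\<omega> * 0 + \<theta>) / \<omega>\<bar> \<le> B / \<omega>"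
      using B[of 1] B[of 0] b1[of "p 1"] b1[of "p 0"] \<open>\<omega> > 0\<close>
      by (auto intro!: divide_right_mono intro: order_trans)
    ultimately have ip: "\<bar>integral {0..1} (\<lambda>v. p v * sin (\<omega> * v + \<theta>))\<bar> \<le> (2 * B + B') / \<omega>"
      unfolding integral_unique[OF hp] by (intro tri) simp_all
    have "\<bar>integral {0..1} (\<lambda>v. (g v - p v) * sin (\<omega> * v + \<theta>))\<bar> \<le> e/2 * (1 - 0)"
      unfolding real_norm_def[symmetric] 
    proof (rule integral_bound)
      show "continuous_on {0..1} (\<lambda>v. (g v - p v) * sin (\<omega> * v + \<theta>))"
        using cp g by (intro continuous_intros) auto
      show "norm ((g v - p v) * sin (\<omega> * v + \<theta>)) \<le> e/2" if "v \<in> {0..1}" for v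
        using p(2)[OF that] b1(2)[of "g v - p v" "\<omega> * v + \<theta>"] by auto
    qed auto
    moreover have "integral {0..1} (\<lambda>v. (g v - p v) * sin (\<omega> * v + \<theta>)) =
        integral {0..1} (\<lambda>v. g v * sin (\<omega> * v + \<theta>)) - integral {0..1} (\<lambda>v. p v * sin (\<omega> * v + \<theta>))"
      unfolding left_diff_distrib using cp g
      by (intro integral_diff integrable_continuous_real continuous_intros) auto
    moreover have "\<bar>x\<bar> \<le> e/2 + C" if "\<bar>d\<bar> \<le> e/2 * (1 - 0)" "d = x - y" "\<bar>y\<bar> \<le> C" for d x y C :: real
      using that abs_triangle_ineq[of "x - y" y] by simp
    ultimately show ?thesis using ip by blast
  qed
  have "((\<lambda>\<omega>. (2 * B + B') / \<omega>) \<longlongrightarrow> 0) at_top" by real_asymp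
  then have "\<forall>\<^sub>F \<omega> in at_top. (2 * B + B') / \<omega> < e / 2"
    by (rule order_tendstoD) (use \<open>e > 0\<close> in auto)
  then show "\<forall>\<^sub>F \<omega> in at_top. dist (integral {0..1} (\<lambda>v. g v * sin (\<omega> * v + \<theta>))) 0 < e"
    using eventually_gt_at_top[of 0]
  proof eventually_elim
    case (elim \<omega>)
    have "\<bar>integral {0..1} (\<lambda>v. g v * sin (\<omega> * v + \<theta>))\<bar> \<le> e/2 + (2 * B + B') / \<omega>"
      using elim(2) by (rule bound)
    also have "\<dots> < e/2 + e/2" using elim(1) by (rule add_strict_left_mono)
    finally show ?case by simp
  qed
qed

corollary Riemann_Lebesgue_cos:
  fixes g :: "real \<Rightarrow> real"
  assumes "continuous_on {0..1} g"
  shows "((\<lambda>\<omega>. integral {0..1} (\<lambda>v. g v * cos (\<omega> * v))) \<longlongrightarrow> 0) at_top"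
  using Riemann_Lebesgue_sin[OF assms, of "pi/2"] by (simp add: sin_add)

section \<open>The sine integral and its asymptotic expansion\<close>

definition sinc_fun :: "real \<Rightarrow> real" where
  "sinc_fun x = (if x = 0 then 1 else sin x / x)"

lemma sinc_fun_mult: "x * sinc_fun x = sin x"
  by (simp add: sinc_fun_def)

lemma continuous_on_sinc_fun [continuous_intros]:
  "continuous_on S f \<Longrightarrow> continuous_on S (\<lambda>x. sinc_fun (f x))"
  unfolding sinc_fun_def by (rule continuous_on_sinc)

lemma Si_has_derivative: "(Si has_real_derivative sinc_fun x) (at x)"
  unfolding sinc_fun_def by (rule DERIV_Si)

lemma Si_0 [simp]: "Si 0 = 0"
  by (simp add: Si_def zero_ereal_def interval_integral_endpoints_same)

text \<open>The combination \<open>h\<close> has derivative \<open>- 2 * sin t / t ^ 3\<close>,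
  dominated by that of \<open>1 / t^2\<close>, and tends to \<open>pi / 2\<close>. The term
  \<open>cos x / x\<close> has to stay explicit because \<open>Si\<close> is later multiplied by the
  length \<open>l\<close>.\<close>

lemma Si_asymptotic:
  assumes "x > 0"
  shows "\<bar>Si x + cos x / x + sin x / x\<^sup>2 - pi / 2\<bar> \<le> 1 / x\<^sup>2"
proof -
  define h where "h t = Si t + cos t / t + sin t / t\<^sup>2" for t
  have h': "(h has_real_derivative - 2 * sin t / t ^ 3) (at t)" if "t > 0" for t
    unfolding h_def using that
    by (auto intro!: derivative_eq_intros Si_has_derivative
        simp: field_simps power2_eq_square power3_eq_cube sinc_fun_def)
  have lim: "(h \<longlongrightarrow> pi / 2) at_top"
  proof -
    have "((\<lambda>t::real. cos t / t) \<longlongrightarrow> 0) at_top" "((\<lambda>t::real. sin t / t\<^sup>2) \<longlongrightarrow> 0) at_top"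
      by real_asymp+
    from tendsto_add[OF tendsto_add[OF Si_at_top this(1)] this(2)]
    show ?thesis unfolding h_def by simp
  qed
  \<comment> \<open>For both signs \<open>s\<close> the sum is nonincreasing, so its value at
    \<open>x\<close> is at least its limit \<open>s * (pi / 2)\<close>; the two signs give the two
    sides of the absolute value.\<close>
  have mono: "1 / t\<^sup>2 + s * h t \<le> 1 / x\<^sup>2 + s * h x" if "t \<ge> x" "\<bar>s\<bar> = 1" for t s
  proof (rule DERIV_nonpos_imp_nonincreasing[OF that(1)])
    fix y assume y: "x \<le> y" "y \<le> t"
    have "((\<lambda>t. 1 / t\<^sup>2 + s * h t) has_real_derivative (- 2 / y ^ 3 + s * (- 2 * sin y / y ^ 3))) (at y)"
      using y \<open>x > 0\<close>
      by (auto intro!: derivative_eq_intros h' simp: field_simps power2_eq_square power3_eq_cube)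
    moreover have "- 2 / y ^ 3 + s * (- 2 * sin y / y ^ 3) = - 2 / y ^ 3 * (1 + s * sin y)"
      by (simp add: algebra_simps add_divide_distrib)
    moreover have "\<dots> \<le> 0"
    proof -
      have "\<bar>s * sin y\<bar> \<le> 1" using that(2) by (simp add: abs_mult)
      moreover have "0 < y ^ 3" using y \<open>x > 0\<close> by simp
      ultimately show ?thesis by (simp add: mult_le_0_iff divide_le_0_iff)
    qed
    ultimately show "\<exists>z. ((\<lambda>t. 1 / t\<^sup>2 + s * h t) has_real_derivative z) (at y) \<and> z \<le> 0" by metis
  qed
  have key: "s * (pi / 2) \<le> 1 / x\<^sup>2 + s * h x" if "\<bar>s\<bar> = 1" for s
  proof -
    have "((\<lambda>t::real. 1 / t\<^sup>2) \<longlongrightarrow> 0) at_top" by real_asymp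
    from tendsto_add[OF this tendsto_mult[OF tendsto_const[of s] lim]]
    have "((\<lambda>t. 1 / t\<^sup>2 + s * h t) \<longlongrightarrow> s * (pi / 2)) at_top" by simp
    then show ?thesis
      by (rule tendsto_upperbound) (use eventually_mono[OF eventually_ge_at_top[of x] mono[OF _ that]] in auto)
  qed
  show ?thesis
    using key[of 1] key[of "-1"] unfolding h_def by (simp add: abs_le_iff)
qed

section \<open>Elementary integrals and the constant\<close>

text \<open>The differences decrease and tend to 0, so none is negative and the sequence increases
  to its limit. This turns concavity and asymptotics of \<open>phi_norm\<close> into a bound with
  the exact constant.\<close>

lemma concave_sequence_le_limit:
  fixes x :: "nat \<Rightarrow> real"
  assumes concave: "\<And>k. x (Suc (Suc k)) + x k \<le> 2 * x (Suc k)" and lim: "x \<longlonglongrightarrow> c"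
  shows "x 0 \<le> c"
proof -
  define d where "d k = x (Suc k) - x k" for k
  have "decseq d"
    unfolding decseq_Suc_iff d_def using concave by (auto simp: algebra_simps)
  moreover have "d \<longlonglongrightarrow> 0"
    unfolding d_def using tendsto_diff[OF LIMSEQ_Suc[OF lim] lim] by simp
  ultimately have "d k \<ge> 0" for k by (rule decseq_ge)
  then have "incseq x" by (auto simp: incseq_Suc_iff d_def)
  then show ?thesis using lim by (rule incseq_le)
qed

lemma
  fixes \<omega> :: real
  assumes "\<omega> \<noteq> 0"
  shows has_integral_cos: "((\<lambda>v. cos (\<omega> * v)) has_integral sin \<omega> / \<omega>) {0..1}"
    and has_integral_sin: "((\<lambda>v. sin (\<omega> * v)) has_integral (1 - cos \<omega>) / \<omega>) {0..1}"
    and has_integral_tent_cos: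
      "((\<lambda>v. (1 - v) * cos (\<omega> * v)) has_integral (1 - cos \<omega>) / \<omega>\<^sup>2) {0..1}"
    and has_integral_tent_sin:
      "((\<lambda>v. (1 - v) * sin (\<omega> * v)) has_integral 1 / \<omega> - sin \<omega> / \<omega>\<^sup>2) {0..1}"
    and has_integral_tent2_cos:
      "((\<lambda>v. (1 - v)\<^sup>2 * cos (\<omega> * v)) has_integral 2 / \<omega>\<^sup>2 - 2 * sin \<omega> / \<omega> ^ 3) {0..1}"
proof -
  have FTC: "(f has_integral F 1 - F 0) {0..1}"
    if "\<And>v. (F has_real_derivative f v) (at v)" for f F :: "real \<Rightarrow> real"
    using that
    by (intro fundamental_theorem_of_calculus)
       (auto simp: has_real_derivative_iff_has_vector_derivative[symmetric] intro: DERIV_subset)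
  have "((\<lambda>v. sin (\<omega> * v) / \<omega>) has_real_derivative cos (\<omega> * v)) (at v)" for v
    using assms by (auto intro!: derivative_eq_intros)
  from FTC[OF this] show "((\<lambda>v. cos (\<omega> * v)) has_integral sin \<omega> / \<omega>) {0..1}" by simp
  have "((\<lambda>v. - cos (\<omega> * v) / \<omega>) has_real_derivative sin (\<omega> * v)) (at v)" for v
    using assms by (auto intro!: derivative_eq_intros)
  from FTC[OF this] show "((\<lambda>v. sin (\<omega> * v)) has_integral (1 - cos \<omega>) / \<omega>) {0..1}"
    by (simp add: diff_divide_distrib)
  have "((\<lambda>v. (1 - v) * sin (\<omega> * v) / \<omega> - cos (\<omega> * v) / \<omega>\<^sup>2) has_real_derivative (1 - v) * cos (\<omega> * v)) (at v)" for v
    using assms by (auto intro!: derivative_eq_intros simp: field_simps power2_eq_square)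
  from FTC[OF this] show "((\<lambda>v. (1 - v) * cos (\<omega> * v)) has_integral (1 - cos \<omega>) / \<omega>\<^sup>2) {0..1}"
    by (simp add: diff_divide_distrib)
  have "((\<lambda>v. - (1 - v) * cos (\<omega> * v) / \<omega> - sin (\<omega> * v) / \<omega>\<^sup>2) has_real_derivative (1 - v) * sin (\<omega> * v)) (at v)" for v
    using assms by (auto intro!: derivative_eq_intros simp: field_simps power2_eq_square)
  from FTC[OF this] show "((\<lambda>v. (1 - v) * sin (\<omega> * v)) has_integral 1 / \<omega> - sin \<omega> / \<omega>\<^sup>2) {0..1}"
    by simp
  have "((\<lambda>v. (1 - v)\<^sup>2 * sin (\<omega> * v) / \<omega> - 2 * (1 - v) * cos (\<omega> * v) / \<omega>\<^sup>2 - 2 * sin (\<omega> * v) / \<omega> ^ 3)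
      has_real_derivative (1 - v)\<^sup>2 * cos (\<omega> * v)) (at v)" for v
    using assms by (auto intro!: derivative_eq_intros simp: field_simps power2_eq_square power3_eq_cube)
  from FTC[OF this] show "((\<lambda>v. (1 - v)\<^sup>2 * cos (\<omega> * v)) has_integral 2 / \<omega>\<^sup>2 - 2 * sin \<omega> / \<omega> ^ 3) {0..1}"
    by simp
qed

text \<open>
  \<open>J_corr v\<close> is the continuous extension to \<open>[0, 1]\<close> of \<open>(J_hat v - 1) / (\<pi> v\<^sup>2)\<close>.
\<close>

definition J_corr :: "real \<Rightarrow> real" where
  "J_corr v = (if v = 0 then - pi / 3 else if v = 1 then - 1 / pi
     else ((1 - v) * cot (pi * v) + 1 / pi - 1 / (pi * v)) / v)"

lemma sin_pi_mult_pos: "0 < v \<Longrightarrow> v < 1 \<Longrightarrow> sin (pi * v) > 0"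
  by (rule sin_gt_zero) (auto simp: mult_less_cancel_left1)

lemma J_hat_eq_J_corr:
  assumes "0 < v" "v < 1"
  shows "J_hat v = 1 + pi * v\<^sup>2 * J_corr v"
  using assms by (simp add: J_hat_def J_corr_def field_simps power2_eq_square)

lemma continuous_on_J_corr: "continuous_on {0..1} J_corr"
proof (rule continuous_on_IccI)
  show "(J_corr \<longlongrightarrow> J_corr 0) (at_right 0)"
  proof (rule Lim_transform_eventually)
    \<comment> \<open>With \<open>x = pi * v\<close> one has
      \<open>J_corr v = pi * (1 - v) * (x * cot x - 1) / x^2\<close>, and \<open>x * cot x\<close>
      expands as \<open>1 - x^2 / 3 + ...\<close>.\<close>
    have "((\<lambda>x::real. (x * cos x / sin x - 1) / x\<^sup>2) \<longlongrightarrow> - 1 / 3) (at_right 0)"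
      by real_asymp
    moreover have "filterlim (\<lambda>v::real. pi * v) (at_right 0) (at_right 0)"
      by real_asymp
    ultimately have "((\<lambda>v. (pi * v * cos (pi * v) / sin (pi * v) - 1) / (pi * v)\<^sup>2) \<longlongrightarrow> - 1 / 3) (at_right 0)"
      by (rule filterlim_compose)
    moreover have "((\<lambda>v. pi * (1 - v)) \<longlongrightarrow> pi * (1 - 0)) (at_right 0)"
      by (intro tendsto_intros)
    ultimately show "((\<lambda>v. pi * (1 - v) * ((pi * v * cos (pi * v) / sin (pi * v) - 1) / (pi * v)\<^sup>2)) \<longlongrightarrow> J_corr 0) (at_right 0)"
      using tendsto_mult by (fastforce simp: J_corr_def)
    have "\<forall>\<^sub>F v in at_right 0. v \<in> {0<..<1::real}" by (rule eventually_at_right_real) simp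
    then show "\<forall>\<^sub>F v in at_right 0. pi * (1 - v) * ((pi * v * cos (pi * v) / sin (pi * v) - 1) / (pi * v)\<^sup>2) = J_corr v"
    proof eventually_elim
      case (elim v)
      then show ?case using sin_pi_mult_pos[of v]
        by (simp add: J_corr_def cot_def field_simps power2_eq_square)
    qed
  qed
  show "(J_corr \<longlongrightarrow> J_corr 1) (at_left 1)"
  proof (rule Lim_transform_eventually)
    \<comment> \<open>Near 1 the cotangent behaves like \<open>1 / (pi * (v - 1))\<close>, so its
      product with \<open>1 - v\<close> tends to \<open>- 1 / pi\<close>.\<close>
    show "((\<lambda>v. ((1 - v) * (cos (pi * v) / sin (pi * v)) + 1 / pi - 1 / (pi * v)) / v) \<longlongrightarrow> J_corr 1) (at_left 1)"
      unfolding J_corr_def by simp (real_asymp, simp add: field_simps)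
    have "\<forall>\<^sub>F v in at_left 1. v \<in> {0<..<1::real}" by (rule eventually_at_left_real) simp
    then show "\<forall>\<^sub>F v in at_left 1. ((1 - v) * (cos (pi * v) / sin (pi * v)) + 1 / pi - 1 / (pi * v)) / v = J_corr v"
    proof eventually_elim
      case (elim v)
      then show ?case by (simp add: J_corr_def cot_def)
    qed
  qed
  fix v :: real assume v: "0 < v" "v < 1"
  have "isCont (\<lambda>v. ((1 - v) * cot (pi * v) + 1 / pi - 1 / (pi * v)) / v) v"
    using v sin_pi_mult_pos[OF v] by (intro continuous_intros) auto
  then have "((\<lambda>v. ((1 - v) * cot (pi * v) + 1 / pi - 1 / (pi * v)) / v) \<longlongrightarrow> J_corr v) (at v)"
    using v by (simp add: isCont_def J_corr_def)
  then show "J_corr \<midarrow>v\<rightarrow> J_corr v"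
  proof (rule Lim_transform_eventually)
    have "\<forall>\<^sub>F u in at v. u \<in> {0<..<1}" using v by (intro eventually_at_in_open') auto
    then show "\<forall>\<^sub>F u in at v. ((1 - u) * cot (pi * u) + 1 / pi - 1 / (pi * u)) / u = J_corr u"
    proof eventually_elim
      case (elim u)
      then show ?case by (simp add: J_corr_def)
    qed
  qed
qed simp

lemma has_integral_cong_interior:
  fixes f g :: "real \<Rightarrow> real"
  assumes "\<And>v. 0 < v \<Longrightarrow> v < 1 \<Longrightarrow> f v = g v"
  shows "(f has_integral I) {0..1} \<longleftrightarrow> (g has_integral I) {0..1}"
proof (rule has_integral_spike_eq[of "{0,1}"])
  fix v :: real assume "v \<in> {0..1} - {0, 1}"
  then have "0 < v" "v < 1" by auto
  then show "g v = f v" using assms by simp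
qed simp

text \<open>Integration by parts with the primitive \<open>(J_hat v^2 - 1) / v\<close> removes the
  derivative and leaves the expression that appears as the limit of
  \<open>phi_norm l - l\<close>.\<close>

lemma c_const_eq:
  "c_const = 4 / 3 - 1 / pi\<^sup>2 + integral {0..1} (\<lambda>v. 2 / pi * J_corr v + v\<^sup>2 * (J_corr v)\<^sup>2)"
proof -
  define m where "m = J_corr"
  note cm = continuous_on_J_corr[folded m_def]
  define I where "I = integral {0..1} (\<lambda>v. 2 / pi * m v + v\<^sup>2 * (m v)\<^sup>2)"
  have I: "((\<lambda>v. 2 / pi * m v + v\<^sup>2 * (m v)\<^sup>2) has_integral I) {0..1}"
    unfolding I_def using cm by (intro integrable_integral integrable_continuous_real continuous_intros) auto
  \<comment> \<open>\<open>H\<close> extends \<open>(J_hat v^2 - 1) / v\<close> continuously to both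
    endpoints, so the fundamental theorem also yields integrability of the integrand in
    \<open>c_const\<close>.\<close>
  define H where "H v = 2 * pi * v * m v + pi\<^sup>2 * v ^ 3 * (m v)\<^sup>2" for v
  have "((\<lambda>v. 2 * (J_hat v * deriv J_hat v / v) - pi\<^sup>2 * (2 / pi * m v + v\<^sup>2 * (m v)\<^sup>2)) has_integral H 1 - H 0) {0..1}"
  proof (rule fundamental_theorem_of_calculus_interior)
    show "continuous_on {0..1} H"
      unfolding H_def using cm by (intro continuous_intros)
    fix v :: real assume "v \<in> {0<..<1}"
    then have v: "0 < v" "v < 1" by auto
    define J where "J t = pi * t * (1 - t) * cot (pi * t) + t" for t
    have Jeq: "J_hat t = J t" if "t \<in> {0<..<1}" for t
      using that by (simp add: J_hat_def J_def)
    \<comment> \<open>Existence suffices: \<open>D\<close> enters the derivative of \<open>H\<close>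
      just as it enters the integrand of \<open>c_const\<close>, so its value never has to be
      computed.\<close>
    have "\<exists>D. (J has_real_derivative D) (at v)"
      unfolding J_def cot_def using sin_pi_mult_pos[OF v]
      by (intro exI) (rule derivative_eq_intros refl | simp)+
    then obtain D where D: "(J has_real_derivative D) (at v)" by blast
    have JD: "(J_hat has_real_derivative D) (at v)"
      by (rule has_field_derivative_transform_within_open[OF D, of "{0<..<1}"]) (use v Jeq in auto)
    then have "deriv J_hat v = D" by (rule DERIV_imp_deriv)
    have HJ: "((J_hat t)\<^sup>2 - 1) / t = H t" if "t \<in> {0<..<1}" for t
      using that by (simp add: J_hat_eq_J_corr H_def m_def field_simps power2_eq_square power3_eq_cube)
    have "((\<lambda>t. ((J_hat t)\<^sup>2 - 1) / t) has_real_derivative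
        (2 * J_hat v * D * v - ((J_hat v)\<^sup>2 - 1)) / (v * v)) (at v)"
      using v by (auto intro!: derivative_eq_intros JD)
    then have HD: "(H has_real_derivative (2 * J_hat v * D * v - ((J_hat v)\<^sup>2 - 1)) / (v * v)) (at v)"
      by (rule has_field_derivative_transform_within_open[of _ _ _ "{0<..<1}"]) (use v HJ in auto)
    have "(2 * J_hat v * D * v - ((J_hat v)\<^sup>2 - 1)) / (v * v) = 2 * (J_hat v * D / v) - ((J_hat v)\<^sup>2 - 1) / (v * v)"
      using v by (simp add: field_simps)
    also have "((J_hat v)\<^sup>2 - 1) / (v * v) = pi\<^sup>2 * (2 / pi * m v + v\<^sup>2 * (m v)\<^sup>2)"
      using v by (simp add: J_hat_eq_J_corr m_def field_simps power2_eq_square)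
    finally show "(H has_vector_derivative
        2 * (J_hat v * deriv J_hat v / v) - pi\<^sup>2 * (2 / pi * m v + v\<^sup>2 * (m v)\<^sup>2)) (at v)"
      using HD \<open>deriv J_hat v = D\<close> by (simp add: has_real_derivative_iff_has_vector_derivative)
  qed simp
  moreover have "H 1 - H 0 = - 1"
    by (simp add: H_def m_def J_corr_def power2_eq_square)
  ultimately have "((\<lambda>v. 2 * (J_hat v * deriv J_hat v / v) - pi\<^sup>2 * (2 / pi * m v + v\<^sup>2 * (m v)\<^sup>2)) has_integral -1) {0..1}"
    by simp
  from has_integral_add[OF this has_integral_mult_right[OF I, of "pi\<^sup>2"]]
  have "((\<lambda>v. 2 * (J_hat v * deriv J_hat v / v)) has_integral (pi\<^sup>2 * I - 1)) {0..1}"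
    by simp
  from has_integral_mult_right[OF this, of "1/2"]
  have "((\<lambda>v. J_hat v * deriv J_hat v / v) has_integral (pi\<^sup>2 * I - 1) / 2) {0..1}"
    by simp
  then have "integral {0..1} (\<lambda>v. J_hat v * deriv J_hat v / v) = (pi\<^sup>2 * I - 1) / 2"
    by (rule integral_unique)
  then have "c_const = 4 / 3 - 1 / pi\<^sup>2 + I"
    unfolding c_const_def by (simp add: field_simps)
  then show ?thesis unfolding I_def m_def .
qed

section \<open>The test function\<close>

text \<open>
  For \<open>0 < v < 1\<close> this is \<open>J_hat v * sin (\<pi> l v) / (\<pi> v) + (1 - v) * cos (\<pi> l v)\<close>, and its even
  extension is the Fourier transform of the Beurling-Selberg majorant, of exponential type \<open>2\<pi>\<close>, of
  an interval of length \<open>l\<close>.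
\<close>

definition phi :: "real \<Rightarrow> real \<Rightarrow> real" where
  "phi l v = l * sinc_fun (pi * l * v) + v * J_corr v * sin (pi * l * v) + (1 - v) * cos (pi * l * v)"

lemma continuous_on_phi: "continuous_on {0..1} (phi l)"
  unfolding phi_def by (intro continuous_intros continuous_on_J_corr)

lemma phi_eq:
  assumes "0 < v" "v < 1"
  shows "phi l v = ((1 - v) * cot (pi * v) + 1 / pi) * sin (pi * l * v) + (1 - v) * cos (pi * l * v)"
proof -
  have J: "v * J_corr v = (1 - v) * cot (pi * v) + 1 / pi - 1 / (pi * v)"
    using assms by (simp add: J_corr_def)
  have sinc: "l * sinc_fun (pi * l * v) = 1 / (pi * v) * sin (pi * l * v)"
    using assms by (simp add: sinc_fun_def)
  show ?thesis
    unfolding phi_def J sinc by (simp add: left_diff_distrib distrib_right)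
qed

text \<open>For \<open>v > 0\<close>, \<open>phi l v\<close> combines
  \<open>sin (pi * l * v)\<close> and \<open>cos (pi * l * v)\<close> with coefficients free of
  \<open>l\<close>, so modulation becomes a shift of \<open>l\<close>. The new parameters
  \<open>l + 2 * x\<close> and \<open>l - 2 * x\<close> are twice the signed distances from
  \<open>x\<close> to the ends of the interval from \<open>- l / 2\<close> to
  \<open>l / 2\<close>.\<close>

lemma phi_mult_cos:
  "2 * phi l v * cos (2 * pi * x * v) = phi (l + 2 * x) v + phi (l - 2 * x) v" if "0 < v"
proof -
  have s: "y * sinc_fun (pi * y * v) = sin (pi * y * v) / (pi * v)" for y
    using that by (simp add: sinc_fun_def)
  have "pi * (l + 2 * x) * v = pi * l * v + 2 * pi * x * v" "pi * (l - 2 * x) * v = pi * l * v - 2 * pi * x * v"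
    by (simp_all add: algebra_simps)
  then show ?thesis
    unfolding phi_def s using that by (simp add: sin_add sin_diff cos_add cos_diff field_simps)
qed

text \<open>
  Shifting \<open>l\<close> by 2 cancels the cotangent, which makes the increments of the integral of \<open>phi l\<close>
  elementary; the same happens for the second differences, with step 1, of the integral of the square.
\<close>

lemma phi_step:
  assumes "0 < v" "v < 1"
  shows "phi (l + 2) v - phi l v = 2 * ((1 - v) * cos (pi * (l + 2) * v))
           + (sin (pi * (l + 2) * v) - sin (pi * l * v)) / pi"
proof -
  define S where "S = sin (pi * v)"
  define C where "C = cos (pi * v)"
  define s where "s = sin (pi * l * v)"
  define c where "c = cos (pi * l * v)"
  have S: "S \<noteq> 0" using sin_pi_mult_pos[OF assms] by (simp add: S_def)
  \<comment> \<open>The shift adds twice the angle \<open>pi * v\<close>, so the increment of the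
    sine carries a factor \<open>S\<close>, which cancels the denominator of the cotangent.\<close>
  have arg: "pi * (l + 2) * v = pi * l * v + 2 * (pi * v)" by (simp add: algebra_simps)
  have 1: "sin (pi * (l + 2) * v) = s * (1 - 2 * S\<^sup>2) + c * (2 * S * C)"
    unfolding arg sin_add cos_double_sin sin_double s_def c_def S_def C_def by simp
  have 2: "cos (pi * (l + 2) * v) = c * (1 - 2 * S\<^sup>2) - s * (2 * S * C)"
    unfolding arg cos_add cos_double_sin sin_double s_def c_def S_def C_def by simp
  have CS: "C * C = 1 - S * S"
    using sin_cos_squared_add[of "pi * v"] by (simp add: S_def C_def power2_eq_square)
  show ?thesis
    unfolding phi_eq[OF assms] 1 2 unfolding s_def[symmetric] c_def[symmetric] cot_def
      S_def[symmetric] C_def[symmetric]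
    using S by (simp add: field_simps power2_eq_square) (use CS in algebra)
qed

lemma phi_square_second_difference:
  assumes "0 < v" "v < 1"
  shows "2 * ((phi (l + 1) v)\<^sup>2 + (phi (l - 1) v)\<^sup>2 - 2 * (phi l v)\<^sup>2) =
           4 * ((1 - v)\<^sup>2 * cos (2 * pi * (l + 1) * v))
         + 4 / pi * ((1 - v) * sin (2 * pi * (l + 1) * v) - (1 - v) * sin (2 * pi * l * v))
         + 2 / pi\<^sup>2 * (cos (2 * pi * l * v) - cos (2 * pi * (l + 1) * v) / 2 - cos (2 * pi * (l - 1) * v) / 2)"
proof -
  define w where "w = 1 - v"
  define \<sigma> where "\<sigma> = sin (pi * v)"
  define \<kappa> where "\<kappa> = cos (pi * v)"
  define S where "S = sin (2 * pi * l * v)"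
  define C where "C = cos (2 * pi * l * v)"
  define \<alpha> where "\<alpha> = w * (\<kappa> / \<sigma>) + 1 / pi"
  have \<sigma>: "\<sigma> \<noteq> 0" using sin_pi_mult_pos[OF assms] by (simp add: \<sigma>_def)
  have sq: "2 * (phi y v)\<^sup>2 = \<alpha>\<^sup>2 * (1 - cos (2 * pi * y * v)) + w\<^sup>2 * (1 + cos (2 * pi * y * v))
      + 2 * \<alpha> * w * sin (2 * pi * y * v)" for y
  proof -
    have d: "2 * pi * y * v = 2 * (pi * y * v)" by simp
    have "phi y v = \<alpha> * sin (pi * y * v) + w * cos (pi * y * v)"
      unfolding phi_eq[OF assms] \<alpha>_def w_def cot_def \<sigma>_def \<kappa>_def ..
    moreover have c2: "1 + cos (2 * (pi * y * v)) = 2 * (cos (pi * y * v))\<^sup>2"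
      "1 - cos (2 * (pi * y * v)) = 2 * (sin (pi * y * v))\<^sup>2"
      by (simp_all add: cos_double_cos) (simp add: cos_squared_eq)
    ultimately show ?thesis
      unfolding d sin_double c2 by (simp add: power2_eq_square algebra_simps)
  qed
  have argp: "2 * pi * (l + 1) * v = 2 * pi * l * v + 2 * (pi * v)"
    and argm: "2 * pi * (l - 1) * v = 2 * pi * l * v - 2 * (pi * v)" by (simp_all add: algebra_simps)
  have trig: "cos (2 * pi * (l + 1) * v) = C * (1 - 2 * \<sigma>\<^sup>2) - S * (2 * \<sigma> * \<kappa>)"
    "sin (2 * pi * (l + 1) * v) = S * (1 - 2 * \<sigma>\<^sup>2) + C * (2 * \<sigma> * \<kappa>)"
    "cos (2 * pi * (l - 1) * v) = C * (1 - 2 * \<sigma>\<^sup>2) + S * (2 * \<sigma> * \<kappa>)"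
    "sin (2 * pi * (l - 1) * v) = S * (1 - 2 * \<sigma>\<^sup>2) - C * (2 * \<sigma> * \<kappa>)"
    unfolding argp argm sin_add cos_add sin_diff cos_diff cos_double_sin sin_double
      S_def C_def \<sigma>_def \<kappa>_def by simp_all
  have \<kappa>\<sigma>: "\<kappa>\<^sup>2 = 1 - \<sigma>\<^sup>2"
    unfolding \<kappa>_def \<sigma>_def by (rule cos_squared_eq)
  have \<alpha>\<sigma>: "\<alpha> * \<sigma> = w * \<kappa> + \<sigma> / pi" using \<sigma> by (simp add: \<alpha>_def field_simps)
  have "2 * ((phi (l + 1) v)\<^sup>2 + (phi (l - 1) v)\<^sup>2 - 2 * (phi l v)\<^sup>2)
     = 2 * (phi (l + 1) v)\<^sup>2 + 2 * (phi (l - 1) v)\<^sup>2 - 2 * (2 * (phi l v)\<^sup>2)" by simp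
  \<comment> \<open>The second difference multiplies the sine and cosine of
    \<open>2 * pi * l * v\<close> by \<open>- 4 * \<sigma>^2\<close>, so \<open>\<alpha>\<close>
    occurs only through \<open>\<alpha> * \<sigma>\<close>, which is free of the cotangent.\<close>
  also have "\<dots> = 4 * C * ((\<alpha> * \<sigma>)\<^sup>2 - w\<^sup>2 * \<sigma>\<^sup>2) - 8 * (\<alpha> * \<sigma>) * \<sigma> * w * S"
    unfolding sq trig
      S_def[symmetric] C_def[symmetric]
    by (simp add: power2_eq_square algebra_simps)
  also have "\<dots> = 4 * (w\<^sup>2 * (C * (1 - 2 * \<sigma>\<^sup>2) - S * (2 * \<sigma> * \<kappa>)))
     + 4 / pi * (w * (S * (1 - 2 * \<sigma>\<^sup>2) + C * (2 * \<sigma> * \<kappa>)) - w * S)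
     + 2 / pi\<^sup>2 * (C - (C * (1 - 2 * \<sigma>\<^sup>2) - S * (2 * \<sigma> * \<kappa>)) / 2 - (C * (1 - 2 * \<sigma>\<^sup>2) + S * (2 * \<sigma> * \<kappa>)) / 2)"
    unfolding \<alpha>\<sigma> power2_sum power_mult_distrib \<kappa>\<sigma>
    by (simp add: power_divide field_simps) (simp add: power2_eq_square algebra_simps)
  finally show ?thesis unfolding trig S_def C_def w_def .
qed

section \<open>The integral of \<open>phi l\<close>: half of Beurling's majorant of the signum
  function at \<open>l / 2\<close>\<close>

lemma integral_phi_split:
  "integral {0..1} (phi l) = Si (pi * l) / pi
     + integral {0..1} (\<lambda>v. v * J_corr v * sin (pi * l * v)) + integral {0..1} (\<lambda>v. (1 - v) * cos (pi * l * v))"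
proof -
  have "((\<lambda>v. l * sinc_fun (pi * l * v)) has_integral Si (pi * l * 1) / pi - Si (pi * l * 0) / pi) {0..1}"
  proof (rule fundamental_theorem_of_calculus)
    fix v :: real
    have "((\<lambda>v. Si (pi * l * v) / pi) has_real_derivative l * sinc_fun (pi * l * v)) (at v within {0..1})"
      by (auto intro!: derivative_eq_intros DERIV_chain2[OF Si_has_derivative])
    then show "((\<lambda>v. Si (pi * l * v) / pi) has_vector_derivative l * sinc_fun (pi * l * v)) (at v within {0..1})"
      by (simp add: has_real_derivative_iff_has_vector_derivative)
  qed simp
  then have sinc: "integral {0..1} (\<lambda>v. l * sinc_fun (pi * l * v)) = Si (pi * l * 1) / pi - Si (pi * l * 0) / pi"
    by (rule integral_unique)
  have split: "integral {0..1} (phi l) = integral {0..1} (\<lambda>v. l * sinc_fun (pi * l * v))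
     + integral {0..1} (\<lambda>v. v * J_corr v * sin (pi * l * v)) + integral {0..1} (\<lambda>v. (1 - v) * cos (pi * l * v))"
    unfolding phi_def
    by (subst integral_add, intro integrable_continuous_real continuous_intros continuous_on_J_corr,
        intro integrable_continuous_real continuous_intros,
        subst integral_add, intro integrable_continuous_real continuous_intros,
        intro integrable_continuous_real continuous_intros continuous_on_J_corr, rule refl)
  show ?thesis unfolding split sinc by simp
qed

lemma integral_phi_tendsto: "((\<lambda>l. integral {0..1} (phi l)) \<longlongrightarrow> 1 / 2) at_top"
proof -
  have f: "filterlim (\<lambda>l. pi * l) at_top at_top" by real_asymp
  have "((\<lambda>l. Si (pi * l) / pi) \<longlongrightarrow> pi / 2 / pi) at_top"
    by (intro tendsto_divide filterlim_compose[OF Si_at_top f]) auto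
  moreover have "((\<lambda>l. integral {0..1} (\<lambda>v. v * J_corr v * sin (pi * l * v))) \<longlongrightarrow> 0) at_top"
    using filterlim_compose[OF Riemann_Lebesgue_sin[of "\<lambda>v. v * J_corr v" 0] f]
    by (simp add: continuous_intros continuous_on_J_corr)
  moreover have "((\<lambda>l. integral {0..1} (\<lambda>v. (1 - v) * cos (pi * l * v))) \<longlongrightarrow> 0) at_top"
    using filterlim_compose[OF Riemann_Lebesgue_cos[of "\<lambda>v. 1 - v"] f]
    by (simp add: continuous_intros)
  ultimately have "((\<lambda>l. integral {0..1} (phi l)) \<longlongrightarrow> pi / 2 / pi + 0 + 0) at_top"
    unfolding integral_phi_split by (intro tendsto_add)
  then show ?thesis by simp
qed

lemma integral_phi_step:
  assumes "l > 0"
  shows "integral {0..1} (phi (l + 2)) \<le> integral {0..1} (phi l)"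
proof -
  define a where "a = pi * (l + 2)"
  define b where "b = pi * l"
  have ab: "a = b + 2 * pi" "b > 0" "a > 0" using assms by (auto simp: a_def b_def distrib_left intro!: mult_pos_pos add_pos_pos)
  \<comment> \<open>The shift of \<open>l\<close> by 2 is a full period, so both numerators agree
    and the increment is a negative multiple of \<open>1 - cos b\<close>.\<close>
  have cos: "cos a = cos b" unfolding ab by simp
  have "((\<lambda>v. 2 * ((1 - v) * cos (a * v)) + (sin (a * v) - sin (b * v)) / pi) has_integral
      2 * ((1 - cos a) / a\<^sup>2) + ((1 - cos a) / a - (1 - cos b) / b) / pi) {0..1}"
    using ab by (intro has_integral_add has_integral_mult_right has_integral_divide has_integral_diff
        has_integral_sin has_integral_tent_cos) auto
  then have "((\<lambda>v. phi (l + 2) v - phi l v) has_integral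
      2 * ((1 - cos a) / a\<^sup>2) + ((1 - cos a) / a - (1 - cos b) / b) / pi) {0..1}"
    by (subst has_integral_cong_interior[where g = "\<lambda>v. 2 * ((1 - v) * cos (a * v)) + (sin (a * v) - sin (b * v)) / pi"])
       (auto simp: phi_step a_def b_def)
  moreover have "((\<lambda>v. phi (l + 2) v - phi l v) has_integral integral {0..1} (phi (l + 2)) - integral {0..1} (phi l)) {0..1}"
    by (intro has_integral_diff integrable_integral integrable_continuous_real continuous_on_phi)
  ultimately have "integral {0..1} (phi (l + 2)) - integral {0..1} (phi l) =
      2 * ((1 - cos a) / a\<^sup>2) + ((1 - cos a) / a - (1 - cos b) / b) / pi"
    by (rule has_integral_unique[symmetric])
  also have "((1 - cos a) / a - (1 - cos b) / b) / pi = - 2 * (1 - cos b) / (a * b)"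
    unfolding cos using ab by (simp add: divide_simps) (simp add: algebra_simps)
  also have "2 * ((1 - cos a) / a\<^sup>2) + - 2 * (1 - cos b) / (a * b) = - (2 * (a - b) * (1 - cos b) / (a\<^sup>2 * b))"
    unfolding cos using ab(2,3) by (simp add: divide_simps power2_eq_square) (simp add: algebra_simps)
  also have "\<dots> \<le> 0" using ab by simp
  finally show ?thesis by simp
qed

text \<open>Along steps of length 2 the integral decreases to its limit \<open>1 / 2\<close>, hence
  is never below it.\<close>

lemma integral_phi_ge:
  assumes "l \<ge> 0"
  shows "integral {0..1} (phi l) \<ge> 1 / 2"
proof (cases "l = 0")
  \<comment> \<open>The step formula divides by \<open>l\<close>, so \<open>l = 0\<close> is
    separate: there \<open>phi\<close> reduces to \<open>1 - v\<close> and equality holds.\<close>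
  case True
  have "((\<lambda>v::real. 1 - v) has_integral (1 - 1\<^sup>2 / 2) - (0 - 0\<^sup>2 / 2)) {0..1}"
    by (rule fundamental_theorem_of_calculus)
       (auto intro!: derivative_eq_intros simp: has_real_derivative_iff_has_vector_derivative[symmetric])
  then show ?thesis
    unfolding True phi_def by (simp add: integral_unique)
next
  case False
  with assms have l: "l > 0" by simp
  have "decseq (\<lambda>k. integral {0..1} (phi (l + 2 * real k)))"
    unfolding decseq_Suc_iff
  proof
    fix k
    have "l + 2 * real (Suc k) = (l + 2 * real k) + 2" by simp
    show "integral {0..1} (phi (l + 2 * real (Suc k))) \<le> integral {0..1} (phi (l + 2 * real k))"
      unfolding \<open>l + 2 * real (Suc k) = (l + 2 * real k) + 2\<close>
      by (rule integral_phi_step) (use l in simp)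
  qed
  moreover have "(\<lambda>k. integral {0..1} (phi (l + 2 * real k))) \<longlonglongrightarrow> 1 / 2"
    by (rule filterlim_compose[OF integral_phi_tendsto]) real_asymp
  ultimately have "1 / 2 \<le> integral {0..1} (phi (l + 2 * real 0))" by (rule decseq_ge)
  then show ?thesis by simp
qed

text \<open>The majorant property: after \<open>phi_mult_cos\<close>, each endpoint of the interval
  contributes at least \<open>1 / 2\<close>.\<close>

lemma integral_phi_cos_ge:
  assumes "\<bar>2 * x\<bar> \<le> l"
  shows "2 * integral {0..1} (\<lambda>v. phi l v * cos (2 * pi * x * v)) \<ge> 1"
proof -
  have "((\<lambda>v. phi (l + 2 * x) v + phi (l - 2 * x) v) has_integral
      integral {0..1} (phi (l + 2 * x)) + integral {0..1} (phi (l - 2 * x))) {0..1}"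
    by (intro has_integral_add integrable_integral integrable_continuous_real continuous_on_phi)
  then have "((\<lambda>v. 2 * (phi l v * cos (2 * pi * x * v))) has_integral
      integral {0..1} (phi (l + 2 * x)) + integral {0..1} (phi (l - 2 * x))) {0..1}"
    by (subst has_integral_cong_interior[where g = "\<lambda>v. phi (l + 2 * x) v + phi (l - 2 * x) v"])
       (auto simp: phi_mult_cos[symmetric])
  then have "2 * integral {0..1} (\<lambda>v. phi l v * cos (2 * pi * x * v)) =
      integral {0..1} (phi (l + 2 * x)) + integral {0..1} (phi (l - 2 * x))"
    by (metis integral_mult_right integral_unique)
  moreover have "l + 2 * x \<ge> 0" "l - 2 * x \<ge> 0" using assms by linarith+
  note integral_phi_ge[OF this(1)] integral_phi_ge[OF this(2)]
  ultimately show ?thesis by linarith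
qed

section \<open>The norm of the test function\<close>

text \<open>The squared norm of the even extension of \<open>phi l\<close> to the interval from -1
  to 1, whence the factor 2.\<close>

definition phi_norm :: "real \<Rightarrow> real" where
  "phi_norm l = 2 * integral {0..1} (\<lambda>v. (phi l v)\<^sup>2)"

lemma has_integral_phi_norm: "((\<lambda>v. 2 * (phi l v)\<^sup>2) has_integral phi_norm l) {0..1}"
  unfolding phi_norm_def
  by (intro has_integral_mult_right integrable_integral integrable_continuous_real
      continuous_intros continuous_on_phi)

text \<open>Double angles separate the terms that contribute to the asymptotics from those
  oscillating with frequency \<open>2 * pi * l\<close> and amplitude continuous in \<open>v\<close>
  and independent of \<open>l\<close>, to which the Riemann-Lebesgue lemma applies.\<close>

lemma phi_square:
  "2 * (phi l v)\<^sup>2 = 2 * l\<^sup>2 * (sinc_fun (pi * l * v))\<^sup>2 + 4 * l * sinc_fun (2 * pi * l * v)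
     + (2 / pi * J_corr v + v\<^sup>2 * (J_corr v)\<^sup>2) + (1 - v)\<^sup>2
     + ((1 - v)\<^sup>2 - (2 / pi * J_corr v + v\<^sup>2 * (J_corr v)\<^sup>2)) * cos (2 * pi * l * v)
     + (2 * (1 - v) * v * J_corr v - 2 / pi) * sin (2 * pi * l * v)"
proof -
  define t where "t = pi * l * v"
  define \<sigma> where "\<sigma> = l * sinc_fun t"
  define s where "s = sin t"
  define c where "c = cos t"
  define m where "m = J_corr v"
  have t: "2 * pi * l * v = 2 * t" by (simp add: t_def)
  \<comment> \<open>Every cross term with a spare factor \<open>v\<close> loses its sinc by this
    identity; only \<open>4 * \<sigma> * c\<close> keeps one.\<close>
  have v\<sigma>: "v * \<sigma> = s / pi"
    using sinc_fun_mult[of t] by (simp add: \<sigma>_def s_def t_def field_simps)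
  have "sinc_fun (2 * t) = sinc_fun t * c"
    by (simp add: sinc_fun_def c_def sin_double)
  then have sinc2: "4 * l * sinc_fun (2 * t) = 4 * \<sigma> * c" by (simp add: \<sigma>_def)
  have c2: "cos (2 * t) = 1 - 2 * s\<^sup>2" and s2: "sin (2 * t) = 2 * s * c"
    by (simp_all add: s_def c_def cos_double_sin sin_double)
  have cc: "c\<^sup>2 = 1 - s\<^sup>2" by (simp add: s_def c_def cos_squared_eq)
  have "2 * (phi l v)\<^sup>2 = 2 * (\<sigma> + v * m * s + (1 - v) * c)\<^sup>2"
    unfolding phi_def t_def[symmetric] \<sigma>_def s_def c_def m_def ..
  also have "\<dots> = 2 * \<sigma>\<^sup>2 + 2 * v\<^sup>2 * m\<^sup>2 * s\<^sup>2 + 2 * (1 - v)\<^sup>2 * c\<^sup>2 + 4 * (v * \<sigma>) * m * s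
      + (4 * \<sigma> * c - 4 * (v * \<sigma>) * c) + 4 * v * m * s * (1 - v) * c"
    by (simp add: power2_eq_square algebra_simps)
  also have "\<dots> = 2 * \<sigma>\<^sup>2 + 4 * \<sigma> * c + (2 / pi * m + v\<^sup>2 * m\<^sup>2) + (1 - v)\<^sup>2
     + ((1 - v)\<^sup>2 - (2 / pi * m + v\<^sup>2 * m\<^sup>2)) * (1 - 2 * s\<^sup>2)
     + (2 * (1 - v) * v * m - 2 / pi) * (2 * s * c)"
    unfolding v\<sigma> cc by (simp add: power2_eq_square field_simps)
  finally show ?thesis
    unfolding t t_def[symmetric] sinc2 c2 s2 m_def[symmetric] by (simp add: \<sigma>_def power_mult_distrib)
qed

lemma continuous_on_Si: "continuous_on S f \<Longrightarrow> continuous_on S (\<lambda>x. Si (f x))"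
  using continuous_on_compose[of S f Si, OF _ continuous_at_imp_continuous_on]
  by (simp add: isCont_Si o_def)

text \<open>The integrand is a multiple of \<open>sin^2 / v^2\<close>; integrating
  \<open>1 / v^2\<close> by parts leaves \<open>sin (2 * pi * l * v) / v\<close>, a sine
  integral.\<close>

lemma has_integral_sinc_square:
  "((\<lambda>v. 2 * l\<^sup>2 * (sinc_fun (pi * l * v))\<^sup>2) has_integral
     2 * l / pi * Si (2 * pi * l) - 2 / pi\<^sup>2 * (sin (pi * l))\<^sup>2) {0..1}"
proof -
  define A where "A v = 2 * l / pi * Si (2 * pi * l * v) - 2 * l / pi * (sin (pi * l * v) * sinc_fun (pi * l * v))" for v
  have "((\<lambda>v. 2 * l\<^sup>2 * (sinc_fun (pi * l * v))\<^sup>2) has_integral A 1 - A 0) {0..1}"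
  proof (rule fundamental_theorem_of_calculus_interior)
    show "continuous_on {0..1} A"
      unfolding A_def by (intro continuous_intros continuous_on_Si)
    fix v :: real assume "v \<in> {0<..<1}"
    then have v: "0 < v" by simp
    \<comment> \<open>\<open>B\<close> equals \<open>A\<close> for positive arguments and is easy to
      differentiate, whereas \<open>A\<close> is continuous at 0.\<close>
    define B where "B v = 2 * l / pi * Si (2 * pi * l * v) - 2 / pi\<^sup>2 * ((sin (pi * l * v))\<^sup>2 / v)" for v
    have AB: "B u = A u" if "u \<in> {0<..}" for u
      using that by (simp add: A_def B_def sinc_fun_def power2_eq_square field_simps)
    have "((\<lambda>v. (sin (pi * l * v))\<^sup>2 / v) has_real_derivative
        (2 * sin (pi * l * v) * (cos (pi * l * v) * (pi * l)) * v - (sin (pi * l * v))\<^sup>2) / (v * v)) (at v)"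
      using v by (auto intro!: derivative_eq_intros)
    moreover have "((\<lambda>v. Si (2 * pi * l * v)) has_real_derivative
        sinc_fun (2 * pi * l * v) * (2 * pi * l)) (at v)"
      by (auto intro!: derivative_eq_intros DERIV_chain2[OF Si_has_derivative])
    ultimately have "(B has_real_derivative 2 * l / pi * (sinc_fun (2 * pi * l * v) * (2 * pi * l))
        - 2 / pi\<^sup>2 * ((2 * sin (pi * l * v) * (cos (pi * l * v) * (pi * l)) * v - (sin (pi * l * v))\<^sup>2) / (v * v))) (at v)"
      unfolding B_def by (intro DERIV_diff DERIV_cmult)
    also have "2 * l / pi * (sinc_fun (2 * pi * l * v) * (2 * pi * l))
        - 2 / pi\<^sup>2 * ((2 * sin (pi * l * v) * (cos (pi * l * v) * (pi * l)) * v - (sin (pi * l * v))\<^sup>2) / (v * v))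
      = 2 * l\<^sup>2 * (sinc_fun (pi * l * v))\<^sup>2"
    proof -
      have "sin (2 * pi * l * v) = 2 * sin (pi * l * v) * cos (pi * l * v)"
        using sin_double[of "pi * l * v"] by (simp add: mult.assoc)
      then show ?thesis
        using v by (simp add: sinc_fun_def field_simps power2_eq_square)
    qed
    finally have "(A has_real_derivative 2 * l\<^sup>2 * (sinc_fun (pi * l * v))\<^sup>2) (at v)"
      by (rule has_field_derivative_transform_within_open[of _ _ _ "{0<..}"]) (use v AB in auto)
    then show "(A has_vector_derivative 2 * l\<^sup>2 * (sinc_fun (pi * l * v))\<^sup>2) (at v)"
      by (simp add: has_real_derivative_iff_has_vector_derivative)
  qed simp
  moreover have "A 1 - A 0 = 2 * l / pi * Si (2 * pi * l) - 2 / pi\<^sup>2 * (sin (pi * l))\<^sup>2"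
    by (simp add: A_def sinc_fun_def power2_eq_square)
  ultimately show ?thesis by simp
qed

lemma phi_norm_eq:
  "phi_norm l = (2 * l / pi * Si (2 * pi * l) - 2 / pi\<^sup>2 * (sin (pi * l))\<^sup>2) + 2 / pi * Si (2 * pi * l)
     + integral {0..1} (\<lambda>v. 2 / pi * J_corr v + v\<^sup>2 * (J_corr v)\<^sup>2) + 1 / 3
     + integral {0..1} (\<lambda>v. ((1 - v)\<^sup>2 - (2 / pi * J_corr v + v\<^sup>2 * (J_corr v)\<^sup>2)) * cos (2 * pi * l * v))
     + integral {0..1} (\<lambda>v. (2 * (1 - v) * v * J_corr v - 2 / pi) * sin (2 * pi * l * v))"
proof (rule has_integral_unique[OF has_integral_phi_norm])
  have "((\<lambda>v. 4 * l * sinc_fun (2 * pi * l * v)) has_integral 2 / pi * Si (2 * pi * l * 1) - 2 / pi * Si (2 * pi * l * 0)) {0..1}"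
  proof (rule fundamental_theorem_of_calculus)
    fix v :: real
    have "((\<lambda>v. 2 / pi * Si (2 * pi * l * v)) has_real_derivative 4 * l * sinc_fun (2 * pi * l * v)) (at v within {0..1})"
      by (auto intro!: derivative_eq_intros DERIV_chain2[OF Si_has_derivative])
    then show "((\<lambda>v. 2 / pi * Si (2 * pi * l * v)) has_vector_derivative 4 * l * sinc_fun (2 * pi * l * v)) (at v within {0..1})"
      by (simp add: has_real_derivative_iff_has_vector_derivative)
  qed simp
  then have 1: "((\<lambda>v. 4 * l * sinc_fun (2 * pi * l * v)) has_integral 2 / pi * Si (2 * pi * l)) {0..1}" by simp
  have "((\<lambda>v::real. (1 - v)\<^sup>2) has_integral (- ((1 - 1) ^ 3) / 3) - (- ((1 - 0) ^ 3) / 3)) {0..1}"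
    by (rule fundamental_theorem_of_calculus)
       (auto intro!: derivative_eq_intros simp: has_real_derivative_iff_has_vector_derivative[symmetric])
  then have 2: "((\<lambda>v::real. (1 - v)\<^sup>2) has_integral 1 / 3) {0..1}" by simp
  show "((\<lambda>v. 2 * (phi l v)\<^sup>2) has_integral (2 * l / pi * Si (2 * pi * l) - 2 / pi\<^sup>2 * (sin (pi * l))\<^sup>2) + 2 / pi * Si (2 * pi * l)
     + integral {0..1} (\<lambda>v. 2 / pi * J_corr v + v\<^sup>2 * (J_corr v)\<^sup>2) + 1 / 3
     + integral {0..1} (\<lambda>v. ((1 - v)\<^sup>2 - (2 / pi * J_corr v + v\<^sup>2 * (J_corr v)\<^sup>2)) * cos (2 * pi * l * v))
     + integral {0..1} (\<lambda>v. (2 * (1 - v) * v * J_corr v - 2 / pi) * sin (2 * pi * l * v))) {0..1}"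
    unfolding phi_square
    by (intro has_integral_add has_integral_sinc_square 1 2 integrable_integral integrable_continuous_real
        continuous_intros continuous_on_J_corr) auto
qed

text \<open>The term \<open>cos X / X\<close> of the expansion of \<open>Si\<close>, multiplied by
  \<open>2 * l / pi\<close>, cancels the oscillation of the squared sine, leaving
  \<open>- 1 / pi^2\<close>. The second sine integral contributes 1, and with \<open>1 / 3\<close>
  and the \<open>J_corr\<close> integral this is \<open>c_const\<close> in the form of
  \<open>c_const_eq\<close>.\<close>

lemma phi_norm_minus_tendsto: "((\<lambda>l. phi_norm l - l) \<longlongrightarrow> c_const) at_top"
proof -
  have f: "filterlim (\<lambda>l. 2 * pi * l) at_top at_top" by real_asymp
  define E where "E l = 2 * l / pi * Si (2 * pi * l) - 2 / pi\<^sup>2 * (sin (pi * l))\<^sup>2 - l" for l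
  have E_bound: "\<bar>E l + 1 / pi\<^sup>2\<bar> \<le> 1 / (pi ^ 3 * l)" if "l > 0" for l
  proof -
    define X where "X = 2 * pi * l"
    have X: "X > 0" using that by (simp add: X_def)
    have sq: "2 / pi\<^sup>2 * (sin (pi * l))\<^sup>2 = (1 - cos X) / pi\<^sup>2"
      using cos_double_sin[of "pi * l"] by (simp add: X_def mult.assoc)
    have l: "l = X / (2 * pi)" by (simp add: X_def)
    have "E l + 1 / pi\<^sup>2 = X / pi\<^sup>2 * (Si X + cos X / X - pi / 2)"
      unfolding E_def sq X_def[symmetric] unfolding l using X
      by (simp add: power2_eq_square field_simps)
    moreover have "\<bar>Si X + cos X / X - pi / 2\<bar> \<le> 2 / X\<^sup>2"
    proof -
      have "\<bar>sin X / X\<^sup>2\<bar> \<le> 1 / X\<^sup>2" by (simp add: divide_right_mono)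
      with Si_asymptotic[OF X]
      have "\<bar>Si X + cos X / X + sin X / X\<^sup>2 - pi / 2\<bar> + \<bar>sin X / X\<^sup>2\<bar> \<le> 1 / X\<^sup>2 + 1 / X\<^sup>2"
        by (rule add_mono)
      with abs_triangle_ineq4[of "Si X + cos X / X + sin X / X\<^sup>2 - pi / 2" "sin X / X\<^sup>2"]
      have "\<bar>Si X + cos X / X + sin X / X\<^sup>2 - pi / 2 - sin X / X\<^sup>2\<bar> \<le> 1 / X\<^sup>2 + 1 / X\<^sup>2"
        by (rule order_trans)
      then show ?thesis by (simp add: algebra_simps)
    qed
    moreover have "\<bar>X / pi\<^sup>2 * Y\<bar> = X / pi\<^sup>2 * \<bar>Y\<bar>" for Y
      using X by (simp add: abs_mult)
    ultimately have "\<bar>E l + 1 / pi\<^sup>2\<bar> \<le> X / pi\<^sup>2 * (2 / X\<^sup>2)"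
      using X mult_left_mono[of _ "2 / X\<^sup>2" "X / pi\<^sup>2"] by simp
    also have "\<dots> = 1 / (pi ^ 3 * l)"
      using that by (simp add: X_def power2_eq_square power3_eq_cube)
    finally show ?thesis .
  qed
  have "((\<lambda>l. E l + 1 / pi\<^sup>2) \<longlongrightarrow> 0) at_top"
  proof (rule Lim_null_comparison)
    show "\<forall>\<^sub>F l in at_top. norm (E l + 1 / pi\<^sup>2) \<le> 1 / (pi ^ 3 * l)"
      using eventually_gt_at_top[of 0] by eventually_elim (use E_bound in simp)
    show "((\<lambda>l. 1 / (pi ^ 3 * l)) \<longlongrightarrow> 0) at_top" by real_asymp
  qed
  from tendsto_diff[OF this tendsto_const[of "1 / pi\<^sup>2"]]
  have "(E \<longlongrightarrow> - (1 / pi\<^sup>2)) at_top" by simp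
  moreover have "((\<lambda>l. 2 / pi * Si (2 * pi * l)) \<longlongrightarrow> 2 / pi * (pi / 2)) at_top"
    by (intro tendsto_mult tendsto_const filterlim_compose[OF Si_at_top f])
  moreover have "((\<lambda>l. integral {0..1} (\<lambda>v. ((1 - v)\<^sup>2 - (2 / pi * J_corr v + v\<^sup>2 * (J_corr v)\<^sup>2)) * cos (2 * pi * l * v))) \<longlongrightarrow> 0) at_top"
    by (rule filterlim_compose[OF Riemann_Lebesgue_cos f])
       (intro continuous_intros continuous_on_J_corr, auto)
  moreover have "((\<lambda>l. integral {0..1} (\<lambda>v. (2 * (1 - v) * v * J_corr v - 2 / pi) * sin (2 * pi * l * v))) \<longlongrightarrow> 0) at_top"
    using filterlim_compose[OF Riemann_Lebesgue_sin[of "\<lambda>v. 2 * (1 - v) * v * J_corr v - 2 / pi" 0] f]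
    by (simp add: continuous_intros continuous_on_J_corr)
  ultimately have "((\<lambda>l. E l + 2 / pi * Si (2 * pi * l)
     + integral {0..1} (\<lambda>v. 2 / pi * J_corr v + v\<^sup>2 * (J_corr v)\<^sup>2) + 1 / 3
     + integral {0..1} (\<lambda>v. ((1 - v)\<^sup>2 - (2 / pi * J_corr v + v\<^sup>2 * (J_corr v)\<^sup>2)) * cos (2 * pi * l * v))
     + integral {0..1} (\<lambda>v. (2 * (1 - v) * v * J_corr v - 2 / pi) * sin (2 * pi * l * v))) \<longlongrightarrow>
     - (1 / pi\<^sup>2) + 2 / pi * (pi / 2) + integral {0..1} (\<lambda>v. 2 / pi * J_corr v + v\<^sup>2 * (J_corr v)\<^sup>2) + 1 / 3 + 0 + 0) at_top"
    by (intro tendsto_add tendsto_const)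
  then show ?thesis
    unfolding c_const_eq phi_norm_eq E_def by (simp add: algebra_simps)
qed

text \<open>The second difference is elementary by \<open>phi_square_second_difference\<close>, and
  its integral has a closed form \<open>R\<close> whose sign can be read off.\<close>

lemma phi_norm_concave:
  assumes "l > 1"
  shows "phi_norm (l + 1) + phi_norm (l - 1) \<le> 2 * phi_norm l"
proof -
  define s where "s = sin (2 * pi * l)"
  define a where "a = 2 * pi * (l + 1)"
  define b where "b = 2 * pi * l"
  define d where "d = 2 * pi * (l - 1)"
  have nz: "a > 0" "b > 0" "d > 0" using assms by (auto simp: a_def b_def d_def)
  have "a = b + 2 * pi" "d = b - 2 * pi" by (simp_all add: a_def b_def d_def algebra_simps)
  \<comment> \<open>The three frequencies differ by full periods, so a single sine \<open>s\<close>
    occurs in \<open>R\<close>.\<close>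
  then have sin: "sin a = s" "sin b = s" "sin d = s"
    unfolding s_def b_def[symmetric] by (simp_all add: sin_diff)
  define R where "R = 4 * (2 / a\<^sup>2 - 2 * s / a ^ 3) + 4 / pi * ((1 / a - s / a\<^sup>2) - (1 / b - s / b\<^sup>2))
      + 2 / pi\<^sup>2 * (s / b - s / a / 2 - s / d / 2)"
  have "((\<lambda>v. 4 * ((1 - v)\<^sup>2 * cos (a * v)) + 4 / pi * ((1 - v) * sin (a * v) - (1 - v) * sin (b * v))
         + 2 / pi\<^sup>2 * (cos (b * v) - cos (a * v) / 2 - cos (d * v) / 2)) has_integral R) {0..1}"
    unfolding R_def using nz
    by (intro has_integral_add has_integral_mult_right has_integral_divide has_integral_diff
        has_integral_tent2_cos[of a, unfolded sin] has_integral_tent_sin[of a, unfolded sin]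
        has_integral_tent_sin[of b, unfolded sin] has_integral_cos[of a, unfolded sin]
        has_integral_cos[of b, unfolded sin] has_integral_cos[of d, unfolded sin]) simp_all
  then have "((\<lambda>v. 2 * ((phi (l + 1) v)\<^sup>2 + (phi (l - 1) v)\<^sup>2 - 2 * (phi l v)\<^sup>2)) has_integral R) {0..1}"
    unfolding a_def b_def d_def
    by (rule has_integral_cong_interior[THEN iffD1, rotated])
       (rule phi_square_second_difference[symmetric])
  moreover have "((\<lambda>v. 2 * ((phi (l + 1) v)\<^sup>2 + (phi (l - 1) v)\<^sup>2 - 2 * (phi l v)\<^sup>2)) has_integral
      phi_norm (l + 1) + phi_norm (l - 1) - 2 * phi_norm l) {0..1}"
    using has_integral_diff[OF has_integral_add[OF has_integral_phi_norm[of "l + 1"] has_integral_phi_norm[of "l - 1"]]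
        has_integral_mult_right[OF has_integral_phi_norm[of l], of 2]]
    by (simp add: algebra_simps)
  ultimately have "phi_norm (l + 1) + phi_norm (l - 1) - 2 * phi_norm l = R"
    by (rule has_integral_unique[symmetric])
  also have "R = 2 / (pi\<^sup>2 * l * (l + 1)\<^sup>2) * (s * (1 / (l + 1) + 1 / l - 2 / (l - 1)) / (2 * pi) - 1)"
    unfolding R_def a_def b_def d_def using assms
    by (simp add: divide_simps power2_eq_square power3_eq_cube) (simp add: algebra_simps)
  also have "\<dots> \<le> 0"
  proof -
    have "s * (1 / (l + 1) + 1 / l - 2 / (l - 1)) \<le> 4"
    proof -
      have br: "1 / (l + 1) + 1 / l - 2 / (l - 1) \<le> 0" "0 \<le> 1 / (l + 1) + 1 / l"
      proof -
        have "1 / (l + 1) \<le> 1 / (l - 1)" "1 / l \<le> 1 / (l - 1)"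
          using assms by (auto intro!: divide_left_mono)
        then show "1 / (l + 1) + 1 / l - 2 / (l - 1) \<le> 0" by simp
      qed (use assms in simp)
      show ?thesis
      \<comment> \<open>The bracket tends to minus infinity as \<open>l\<close> approaches 1, but
        there \<open>s\<close> is nonnegative, so the product is at most 0; beyond
        \<open>3 / 2\<close> the bracket is at most 4 in absolute value.\<close>
      proof (cases "l \<le> 3 / 2")
        case True
        have "s = sin (2 * pi * (l - 1))" by (simp add: s_def right_diff_distrib sin_diff)
        also have "\<dots> \<ge> 0" using assms True by (intro sin_ge_zero) auto
        finally show ?thesis using br by (smt (verit) mult_nonneg_nonpos)
      next
        case False
        then have "2 / (l - 1) \<le> 4" by (simp add: field_simps)
        with br have "\<bar>1 / (l + 1) + 1 / l - 2 / (l - 1)\<bar> \<le> 4" by linarith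
        moreover have "\<bar>s\<bar> \<le> 1" by (simp add: s_def)
        ultimately have "\<bar>s\<bar> * \<bar>1 / (l + 1) + 1 / l - 2 / (l - 1)\<bar> \<le> 1 * 4"
          by (intro mult_mono) auto
        then show ?thesis by (simp add: abs_mult[symmetric])
      qed
    qed
    also have "4 \<le> 2 * pi" using pi_gt3 by simp
    finally show ?thesis
      using assms by (intro mult_nonneg_nonpos) (auto simp: divide_le_eq)
  qed
  finally show ?thesis by simp
qed

text \<open>Subtracting a linear term preserves concavity, so along \<open>l + k\<close> the
  sequence \<open>x\<close> is concave with limit \<open>c_const\<close>, and its first term lies
  below the limit.\<close>

lemma phi_norm_le:
  assumes "l > 0"
  shows "phi_norm l \<le> l + c_const"
proof -
  define x where "x k = phi_norm (l + real k) - (l + real k)" for k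
  have "x 0 \<le> c_const"
  proof (rule concave_sequence_le_limit)
    show "x \<longlonglongrightarrow> c_const"
      unfolding x_def by (rule filterlim_compose[OF phi_norm_minus_tendsto]) real_asymp
    show "x (Suc (Suc k)) + x k \<le> 2 * x (Suc k)" for k
      using phi_norm_concave[of "l + real (Suc k)"] assms
      by (simp add: x_def algebra_simps)
  qed
  then show ?thesis by (simp add: x_def)
qed

text \<open>No numerical value enters: a squared norm is nonnegative, and \<open>phi_norm e\<close>
  is at most \<open>e + c_const\<close> for every positive \<open>e\<close>.\<close>

lemma c_const_nonneg: "c_const \<ge> 0"
proof (rule field_le_epsilon)
  fix e :: real assume "e > 0"
  have "0 \<le> phi_norm e"
    unfolding phi_norm_def
    by (intro mult_nonneg_nonneg integral_nonneg integrable_continuous_real continuous_intros continuous_on_phi) auto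
  also have "\<dots> \<le> e + c_const" using \<open>e > 0\<close> by (rule phi_norm_le)
  finally show "0 \<le> c_const + e" by simp
qed

section \<open>The Johnsen-Gallagher condition\<close>

definition additive_char :: "real \<Rightarrow> complex" where
  "additive_char x = cis (2 * pi * x)"

lemma additive_char_add: "additive_char (x + y) = additive_char x * additive_char y"
  by (simp add: additive_char_def cis_mult distrib_left)

lemma additive_char_0 [simp]: "additive_char 0 = 1"
  by (simp add: additive_char_def)

lemma cnj_additive_char: "cnj (additive_char x) = additive_char (- x)"
  by (simp add: additive_char_def cis_cnj)

lemma norm_additive_char [simp]: "norm (additive_char x) = 1"
  by (simp add: additive_char_def)

lemma additive_char_of_nat_mult: "additive_char (real n * x) = additive_char x ^ n"
  by (simp add: additive_char_def Complex.DeMoivre mult_ac)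

lemma additive_char_eq_1_iff: "additive_char x = 1 \<longleftrightarrow> x \<in> \<int>"
proof
  assume "additive_char x = 1"
  then have "cos (2 * pi * x) = 1" by (simp add: additive_char_def complex_eq_iff)
  then obtain n :: int where "2 * pi * x = of_int n * 2 * pi" by (auto simp: cos_one_2pi_int)
  then have "x = of_int n" by simp
  then show "x \<in> \<int>" by simp
qed (simp add: additive_char_def)

lemma sum_additive_char_all:
  assumes "q > 0"
  shows "(\<Sum>a<q. additive_char (real a * (of_int m / real q))) = (if int q dvd m then of_nat q else 0)"
proof -
  have iff: "of_int m / real q \<in> \<int> \<longleftrightarrow> int q dvd m"
  proof
    assume "of_int m / real q \<in> \<int>"
    then obtain k where "of_int m / real q = of_int k" by (auto elim: Ints_cases)
    then have "of_int m = (of_int (k * int q) :: real)" using assms by (simp add: field_simps)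
    then have "m = k * int q" by (simp only: of_int_eq_iff)
    then show "int q dvd m" by simp
  next
    assume "int q dvd m"
    then show "of_int m / real q \<in> \<int>" using assms by (auto elim!: dvdE)
  qed
  have "additive_char (of_int m / real q) ^ q = 1"
    using assms by (simp add: additive_char_of_nat_mult[symmetric] additive_char_eq_1_iff)
  then show ?thesis
    unfolding additive_char_of_nat_mult sum_gp_strict additive_char_eq_1_iff iff by simp
qed

text \<open>Residues start at 0, so \<open>reduced_residues 1\<close> is \<open>{0}\<close> and the
  fraction 0/1 is included.\<close>

definition reduced_residues :: "nat \<Rightarrow> nat set" where
  "reduced_residues q = {a. a < q \<and> coprime a q}"

lemma finite_reduced_residues [simp]: "finite (reduced_residues q)"
  by (simp add: reduced_residues_def)

definition ramanujan_sum :: "nat \<Rightarrow> int \<Rightarrow> complex" where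
  "ramanujan_sum q m = (\<Sum>a\<in>reduced_residues q. additive_char (real a * (of_int m / real q)))"

text \<open>Writing each fraction with denominator \<open>q\<close> in lowest terms groups the full
  character sum by the reduced denominator \<open>d\<close>.\<close>

lemma sum_ramanujan_sum_divisors:
  assumes "q > 0"
  shows "(\<Sum>d | d dvd q. ramanujan_sum d m) = (if int q dvd m then of_nat q else 0)"
proof -
  have "(\<Sum>d | d dvd q. ramanujan_sum d m) =
      (\<Sum>(d, a)\<in>Sigma {d. d dvd q} reduced_residues. additive_char (real a * (of_int m / real d)))"
    unfolding ramanujan_sum_def using assms by (intro sum.Sigma) auto
  also have "\<dots> = (\<Sum>a<q. additive_char (real a * (of_int m / real q)))"
  proof (rule sum.reindex_bij_witness[where j = "\<lambda>(d, a). a * (q div d)" and i = "\<lambda>a. (q div gcd a q, a div gcd a q)"])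
    fix x assume "x \<in> Sigma {d. d dvd q} reduced_residues"
    then obtain d a where x: "x = (d, a)" and d: "d dvd q" and a: "a < d" "coprime a d"
      by (auto simp: reduced_residues_def)
    obtain k where k: "q = d * k" using d by blast
    with assms have pos: "d > 0" "k > 0" by auto
    have div: "q div d = k" "q div k = d" using k pos by simp_all
    have gcd: "gcd (a * k) q = k" 
      using a(2) gcd_mult_distrib_nat[of k a d] unfolding k by (simp add: mult.commute)
    show "(case case x of (d, a) \<Rightarrow> a * (q div d) of a \<Rightarrow> (q div gcd a q, a div gcd a q)) = x"
      using pos by (simp add: x div gcd)
    show "(case x of (d, a) \<Rightarrow> a * (q div d)) \<in> {..<q}"
      using a pos by (simp add: x div k)
    show "additive_char (real (case x of (d, a) \<Rightarrow> a * (q div d)) * (of_int m / real q)) =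
        (case x of (d, a) \<Rightarrow> additive_char (real a * (of_int m / real d)))"
      using pos by (simp add: x div k field_simps)
  next
    fix a assume a: "a \<in> {..<q}"
    define g where "g = gcd a q"
    have g: "g > 0" "g dvd a" "g dvd q" using assms by (auto simp: g_def)
    have "coprime (a div g) (q div g)"
      unfolding g_def using assms by (intro div_gcd_coprime) auto
    moreover have "a div g < q div g"
      using a g by (auto elim!: dvdE)
    ultimately show "(q div gcd a q, a div gcd a q) \<in> Sigma {d. d dvd q} reduced_residues"
      using g by (auto simp: reduced_residues_def g_def[symmetric] div_dvd_iff_mult)
    have "q div (q div g) = g" using g assms by (auto elim!: dvdE)
    then show "(case (q div gcd a q, a div gcd a q) of (d, a) \<Rightarrow> a * (q div d)) = a"
      using g by (simp add: g_def[symmetric])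
  qed
  also have "\<dots> = (if int q dvd m then of_nat q else 0)"
    using assms by (rule sum_additive_char_all)
  finally show ?thesis .
qed

text \<open>Divisors of \<open>q\<close> correspond to exponent vectors on its primes, so expanding
  the product over the primes gives the divisor sum.\<close>

lemma sum_divisors_prod_multiplicity:
  fixes h :: "nat \<Rightarrow> nat \<Rightarrow> real"
  assumes "q > 0"
  shows "(\<Sum>d | d dvd q. \<Prod>p\<in>prime_factors d. h p (multiplicity p d)) =
         (\<Prod>p\<in>prime_factors q. 1 + (\<Sum>e=1..multiplicity p q. h p e))"
proof -
  define P where "P = prime_factors q"
  \<comment> \<open>Exponent 0 must contribute the factor 1, because primes not dividing
    \<open>d\<close> are absent from the product over \<open>prime_factors d\<close>.\<close>
  define h' where "h' p e = (if e = 0 then 1 else h p e)" for p e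
  have P: "finite P" "\<And>p. p \<in> P \<Longrightarrow> prime p" by (auto simp: P_def)
  have "(\<Prod>p\<in>P. 1 + (\<Sum>e=1..multiplicity p q. h p e)) = (\<Prod>p\<in>P. \<Sum>e\<in>{0..multiplicity p q}. h' p e)"
  proof (rule prod.cong[OF refl])
    fix p
    have "(\<Sum>e\<in>{0..multiplicity p q}. h' p e) = h' p 0 + (\<Sum>e=1..multiplicity p q. h' p e)"
      by (simp add: sum.atLeast_Suc_atMost)
    also have "\<dots> = 1 + (\<Sum>e=1..multiplicity p q. h p e)"
      by (simp add: h'_def)
    finally show "1 + (\<Sum>e=1..multiplicity p q. h p e) = (\<Sum>e\<in>{0..multiplicity p q}. h' p e)" ..
  qed
  also have "\<dots> = (\<Sum>x\<in>(\<Pi>\<^sub>E p\<in>P. {0..multiplicity p q}). \<Prod>p\<in>P. h' p (x p))"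
    using P by (intro prod_sum_PiE) auto
  also have "\<dots> = (\<Sum>d | d dvd q. \<Prod>p\<in>prime_factors d. h p (multiplicity p d))"
  proof (rule sum.reindex_bij_witness[where j = "\<lambda>x. \<Prod>p\<in>P. p ^ x p" and i = "\<lambda>d. \<lambda>p\<in>P. multiplicity p d"])
    fix x assume x: "x \<in> (\<Pi>\<^sub>E p\<in>P. {0..multiplicity p q})"
    define d where "d = (\<Prod>p\<in>P. p ^ x p)"
    have mult: "multiplicity p d = (if p \<in> P then x p else 0)" if "prime p" for p
      unfolding d_def using P that by (intro multiplicity_prod_prime_powers) auto
    have "0 \<notin> P" using P(2) not_prime_0 by blast
    then have "d \<noteq> 0" using P(1) by (auto simp: d_def)
    have "d dvd q"
      using \<open>d \<noteq> 0\<close> x by (intro multiplicity_le_imp_dvd) (auto simp: mult PiE_def Pi_def)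
    then show "(\<Prod>p\<in>P. p ^ x p) \<in> {d. d dvd q}" by (simp add: d_def)
    show "(\<lambda>p\<in>P. multiplicity p (\<Prod>p\<in>P. p ^ x p)) = x"
      unfolding d_def[symmetric] using x P by (intro ext) (auto simp: mult PiE_def extensional_def)
    have sub: "prime_factors d \<subseteq> P"
      unfolding P_def using \<open>d dvd q\<close> assms by (intro dvd_prime_factors) auto
    have "(\<Prod>p\<in>P. h' p (x p)) = (\<Prod>p\<in>P. h' p (multiplicity p d))"
      by (rule prod.cong) (auto simp: mult P)
    also have "\<dots> = (\<Prod>p\<in>prime_factors d. h' p (multiplicity p d))"
    proof (rule prod.mono_neutral_right[OF P(1) sub], rule ballI)
      fix p assume "p \<in> P - prime_factors d"
      then have "multiplicity p d = 0"
        using P by (auto simp: prime_factors_multiplicity)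
      then show "h' p (multiplicity p d) = 1" by (simp add: h'_def)
    qed
    also have "\<dots> = (\<Prod>p\<in>prime_factors d. h p (multiplicity p d))"
      by (rule prod.cong) (auto simp: h'_def prime_factors_multiplicity)
    finally show "(\<Prod>p\<in>prime_factors (\<Prod>p\<in>P. p ^ x p). h p (multiplicity p (\<Prod>p\<in>P. p ^ x p))) = (\<Prod>p\<in>P. h' p (x p))"
      by (simp add: d_def)
  next
    fix d assume "d \<in> {d. d dvd q}"
    then have d: "d dvd q" "d > 0" using assms by (auto intro: Nat.gr0I)
    show "(\<lambda>p\<in>P. multiplicity p d) \<in> (\<Pi>\<^sub>E p\<in>P. {0..multiplicity p q})"
      using d assms by (auto intro!: dvd_imp_multiplicity_le)
    have sub: "prime_factors d \<subseteq> P"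
      unfolding P_def using d assms by (intro dvd_prime_factors) auto
    have "(\<Prod>p\<in>P. p ^ (\<lambda>p\<in>P. multiplicity p d) p) = (\<Prod>p\<in>P. p ^ multiplicity p d)"
      by (rule prod.cong) auto
    also have "\<dots> = (\<Prod>p\<in>prime_factors d. p ^ multiplicity p d)"
      using P by (intro prod.mono_neutral_right[OF P(1) sub]) (auto simp: prime_factors_multiplicity)
    also have "\<dots> = d" using prime_factorization_nat[OF d(2)] ..
    finally show "(\<Prod>p\<in>P. p ^ (\<lambda>p\<in>P. multiplicity p d) p) = d" .
  qed
  finally show ?thesis unfolding P_def ..
qed

section \<open>Local densities, the function \<open>g_fun\<close> and averages over
  \<open>K q\<close>\<close>

locale sieve_sequence =
  fixes Q :: real and K :: "nat \<Rightarrow> int set"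
  assumes residue: "residue_sequence Q K"
    and multiplicative: "multiplicative_sequence Q K"
    and consistent: "consistent_sequence Q K"
    and jg: "johnsen_gallagher Q K"
begin

lemma moduli_pos: "q \<in> moduli Q \<Longrightarrow> q > 0"
  by (simp add: moduli_def)

lemma moduli_dvd: "q \<in> moduli Q \<Longrightarrow> d dvd q \<Longrightarrow> d \<in> moduli Q"
  using dvd_imp_le[of d q] by (auto simp: moduli_def intro: Nat.gr0I)

lemma K_subset: "q \<in> moduli Q \<Longrightarrow> K q \<subseteq> {0..<int q}"
  using residue by (simp add: residue_sequence_def)

lemma mod_K: "q \<in> moduli Q \<Longrightarrow> x \<in> K q \<Longrightarrow> x mod int q = x"
  using K_subset[of q] by (intro mod_pos_pos_trivial) auto

lemma finite_K: "q \<in> moduli Q \<Longrightarrow> finite (K q)"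
  using K_subset finite_subset by blast

lemma card_K_pos: "q \<in> moduli Q \<Longrightarrow> card (K q) > 0"
  using residue finite_K by (auto simp: residue_sequence_def card_gt_0_iff)

lemma mod_mem_K: "q \<in> moduli Q \<Longrightarrow> d dvd q \<Longrightarrow> x mod int q \<in> K q \<Longrightarrow> x mod int d \<in> K d"
proof -
  assume q: "q \<in> moduli Q" "d dvd q" and "x mod int q \<in> K q"
  then have "(x mod int q) mod int d \<in> K d"
    using consistent unfolding consistent_sequence_def by blast
  then show ?thesis using q(2) by (simp add: mod_mod_cancel)
qed

lemma card_K_1: "1 \<in> moduli Q \<Longrightarrow> card (K 1) = 1"
proof -
  assume 1: "1 \<in> moduli Q"
  have "card (K 1) \<le> card {0..<int 1}" using K_subset[OF 1] by (intro card_mono) auto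
  then show ?thesis using card_K_pos[OF 1] by simp
qed

text \<open>The Chinese Remainder map is injective on residues below \<open>q\<close>, and
  multiplicativity identifies its image with a product set.\<close>

lemma card_K_prod:
  assumes q: "q \<in> moduli Q"
  shows "card (K q) = (\<Prod>p\<in>prime_factors q. card (K (p ^ multiplicity p q)))"
proof -
  have "inj_on (crt_map q) (K q)"
  proof (rule inj_onI)
    fix x y assume xy: "x \<in> K q" "y \<in> K q" "crt_map q x = crt_map q y"
    have "[x = y] (mod (\<Prod>p\<in>prime_factors q. int (p ^ multiplicity p q)))"
    proof (rule cong_cong_prod_coprime)
      show "\<forall>p\<in>prime_factors q. [x = y] (mod int (p ^ multiplicity p q))"
      proof
        fix p assume "p \<in> prime_factors q"
        then show "[x = y] (mod int (p ^ multiplicity p q))"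
          using fun_cong[OF xy(3), of p] by (simp add: crt_map_def cong_def)
      qed
      show "\<forall>p\<in>prime_factors q. \<forall>p'\<in>prime_factors q. p \<noteq> p' \<longrightarrow>
          coprime (int (p ^ multiplicity p q)) (int (p' ^ multiplicity p' q))"
        by (auto intro!: primes_coprime dest: in_prime_factors_imp_prime
            simp del: coprime_power_left_iff coprime_power_right_iff
            intro!: coprime_int_iff[THEN iffD2] coprime_power_left_iff[THEN iffD2] coprime_power_right_iff[THEN iffD2])
    qed
    also have "(\<Prod>p\<in>prime_factors q. int (p ^ multiplicity p q)) = int q"
      using prime_factorization_nat[of q] moduli_pos[OF q] by (metis of_nat_prod)
    finally show "x = y"
      using mod_K[OF q] xy(1,2) by (simp add: cong_def)
  qed
  then have "card (K q) = card (crt_map q ` K q)" by (rule card_image[symmetric])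
  also have "\<dots> = card (\<Pi>\<^sub>E p\<in>prime_factors q. K (p ^ multiplicity p q))"
    using multiplicative q by (simp add: multiplicative_sequence_def)
  finally show ?thesis by (simp add: card_PiE)
qed

text \<open>At each prime the differences defining \<open>g_fun\<close> telescope, and the leading 1
  cancels the value at exponent 0 because \<open>K 1\<close> has one element.\<close>

lemma sum_g_fun_divisors:
  assumes q: "q \<in> moduli Q"
  shows "(\<Sum>d | d dvd q. g_fun K d) = real q / real (card (K q))"
proof -
  have q0: "q > 0" using q by (rule moduli_pos)
  define r where "r p e = real (p ^ e) / real (card (K (p ^ e)))" for p e
  have "(\<Sum>d | d dvd q. g_fun K d) = (\<Prod>p\<in>prime_factors q. 1 + (\<Sum>e=1..multiplicity p q. r p e - r p (e - 1)))"
    unfolding g_fun_def r_def using q0 by (rule sum_divisors_prod_multiplicity)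
  also have "\<dots> = (\<Prod>p\<in>prime_factors q. r p (multiplicity p q))"
  proof (rule prod.cong[OF refl])
    fix p
    have "1 \<in> moduli Q" using q by (rule moduli_dvd) simp
    then have "r p 0 = 1" using card_K_1 by (simp add: r_def)
    moreover have "(\<Sum>e=1..n. r p e - r p (e - 1)) = r p n - r p 0" for n
      by (induction n) auto
    ultimately show "1 + (\<Sum>e=1..multiplicity p q. r p e - r p (e - 1)) = r p (multiplicity p q)" by simp
  qed
  also have "\<dots> = real (\<Prod>p\<in>prime_factors q. p ^ multiplicity p q) / real (\<Prod>p\<in>prime_factors q. card (K (p ^ multiplicity p q)))"
    by (simp add: r_def prod_dividef)
  also have "\<dots> = real q / real (card (K q))"
    using prime_factorization_nat[OF q0] card_K_prod[OF q] by simp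
  finally show ?thesis .
qed

text \<open>The Ramanujan sum depends on \<open>x\<close> only modulo \<open>d\<close>, and by the
  Johnsen-Gallagher condition all classes in \<open>K d\<close> have equally many lifts to
  \<open>K q\<close>. All divisors of \<open>q\<close> can thus be averaged over the single set
  \<open>K q\<close>.\<close>

lemma average_ramanujan_sum:
  assumes q: "q \<in> moduli Q" and d: "d dvd q"
  shows "(\<Sum>x\<in>K d. ramanujan_sum d (n - x)) / of_nat (card (K d)) =
         (\<Sum>x\<in>K q. ramanujan_sum d (n - x)) / of_nat (card (K q))"
proof -
  have dm: "d \<in> moduli Q" using q d by (rule moduli_dvd)
  have per: "ramanujan_sum d (n - x) = ramanujan_sum d (n - x mod int d)" for x
  proof -
    have "additive_char (real a * (of_int (n - x mod int d) / real d)) =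
        additive_char (real a * (of_int (n - x) / real d))" for a
    proof -
      have "x = int d * (x div int d) + x mod int d" by simp
      then have x: "real_of_int x = real d * of_int (x div int d) + of_int (x mod int d)"
        by (metis of_int_add of_int_mult of_int_of_nat_eq)
      have "real a * (of_int (n - x mod int d) / real d) =
          real a * (of_int (n - x) / real d) + of_int (int a * (x div int d))"
        unfolding of_int_diff x using moduli_pos[OF dm] by (simp add: field_simps)
      then show ?thesis by (simp add: additive_char_add additive_char_eq_1_iff[THEN iffD2])
    qed
    then show ?thesis by (simp add: ramanujan_sum_def)
  qed
  have image: "(\<lambda>x. x mod int d) ` K q = K d"
    using consistent q d by (simp add: consistent_sequence_def)
  have "(\<Sum>x\<in>K q. ramanujan_sum d (n - x)) =
      (\<Sum>y\<in>K d. \<Sum>x\<in>{x \<in> K q. x mod int d = y}. ramanujan_sum d (n - x))"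
    using image by (intro sum.group[symmetric] finite_K q dm) auto
  also have "\<dots> = (\<Sum>y\<in>K d. of_real (real (card (K q)) / real (card (K d))) * ramanujan_sum d (n - y))"
  proof (rule sum.cong[OF refl])
    fix y assume y: "y \<in> K d"
    then have "y mod int d = y" using mod_K[OF dm] by simp
    then have "{x \<in> K q. x mod int d = y} = {x \<in> K q. [x = y] (mod int d)}" by (simp add: cong_def)
    then have card: "real (card {x \<in> K q. x mod int d = y}) = real (card (K q)) / real (card (K d))"
      using jg q d y by (simp add: johnsen_gallagher_def)
    have "(\<Sum>x\<in>{x \<in> K q. x mod int d = y}. ramanujan_sum d (n - x)) =
        (\<Sum>x\<in>{x \<in> K q. x mod int d = y}. ramanujan_sum d (n - y))"
    proof (rule sum.cong[OF refl])
      fix x assume "x \<in> {x \<in> K q. x mod int d = y}"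
      then have "x mod int d = y" by simp
      then show "ramanujan_sum d (n - x) = ramanujan_sum d (n - y)" using per[of x] by (simp only:)
    qed
    then show "(\<Sum>x\<in>{x \<in> K q. x mod int d = y}. ramanujan_sum d (n - x)) =
        of_real (real (card (K q)) / real (card (K d))) * ramanujan_sum d (n - y)"
      unfolding card[symmetric] by simp
  qed
  also have "\<dots> = of_real (real (card (K q)) / real (card (K d))) * (\<Sum>y\<in>K d. ramanujan_sum d (n - y))"
    by (rule sum_distrib_left[symmetric])
  finally show ?thesis
    using card_K_pos[OF q] card_K_pos[OF dm] by simp
qed

text \<open>
  Both sides have the same sum \<open>q / |K q|\<close> over the divisors of \<open>q\<close>, so they agree by induction on \<open>q\<close>.
\<close>

lemma average_ramanujan_sum_eq_g_fun:
  assumes "q \<in> moduli Q" and "n mod int q \<in> K q"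
  shows "(\<Sum>x\<in>K q. ramanujan_sum q (n - x)) / of_nat (card (K q)) = of_real (g_fun K q)"
  using assms
proof (induction q rule: less_induct)
  case (less q)
  define G where "G d = (\<Sum>x\<in>K d. ramanujan_sum d (n - x)) / of_nat (card (K d))" for d
  note q = less.prems(1)
  have q0: "q > 0" using q by (rule moduli_pos)
  have "(\<Sum>d | d dvd q. G d) = (\<Sum>d | d dvd q. (\<Sum>x\<in>K q. ramanujan_sum d (n - x)) / of_nat (card (K q)))"
    unfolding G_def by (rule sum.cong[OF refl]) (use average_ramanujan_sum[OF q] in auto)
  also have "\<dots> = (\<Sum>x\<in>K q. \<Sum>d | d dvd q. ramanujan_sum d (n - x)) / of_nat (card (K q))"
    by (subst sum.swap) (simp add: sum_divide_distrib)
  \<comment> \<open>The divisor sum detects \<open>q\<close> dividing \<open>n - x\<close>, so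
    exactly one residue in \<open>K q\<close> survives, the class of \<open>n\<close>.\<close>
  also have "(\<Sum>x\<in>K q. \<Sum>d | d dvd q. ramanujan_sum d (n - x)) = (\<Sum>x\<in>K q. if x = n mod int q then of_nat q else 0)"
  proof (rule sum.cong[OF refl])
    fix x assume "x \<in> K q"
    then have "x mod int q = x" using mod_K[OF q] by simp
    then have "int q dvd n - x \<longleftrightarrow> x = n mod int q" by (auto simp: mod_eq_dvd_iff[symmetric])
    then show "(\<Sum>d | d dvd q. ramanujan_sum d (n - x)) = (if x = n mod int q then of_nat q else 0)"
      using sum_ramanujan_sum_divisors[OF q0] by simp
  qed
  also have "\<dots> = of_nat q"
    using less.prems(2) finite_K[OF q] by simp
  finally have "(\<Sum>d | d dvd q. G d) = of_real (\<Sum>d | d dvd q. g_fun K d)"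
    using sum_g_fun_divisors[OF q] by simp
  moreover have "finite {d. d dvd q \<and> d \<noteq> q}"
    using q0 by (auto intro: finite_subset[OF _ finite_divisors_nat])
  moreover have "{d. d dvd q} = insert q {d. d dvd q \<and> d \<noteq> q}" by auto
  ultimately have "G q + (\<Sum>d | d dvd q \<and> d \<noteq> q. G d) = of_real (g_fun K q + (\<Sum>d | d dvd q \<and> d \<noteq> q. g_fun K d))"
    by simp
  moreover have "(\<Sum>d | d dvd q \<and> d \<noteq> q. G d) = of_real (\<Sum>d | d dvd q \<and> d \<noteq> q. g_fun K d)"
    unfolding of_real_sum
  proof (rule sum.cong[OF refl])
    fix d assume "d \<in> {d. d dvd q \<and> d \<noteq> q}"
    then have d: "d dvd q" "d < q" using q0 by (auto dest: dvd_imp_le)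
    show "G d = of_real (g_fun K d)"
      unfolding G_def using moduli_dvd[OF q d(1)] mod_mem_K[OF q d(1) less.prems(2)] d(2)
      by (intro less.IH)
  qed
  ultimately show ?case by (simp add: G_def)
qed

text \<open>The coefficients \<open>c a\<close> average the conjugate characters over
  \<open>K q\<close>, so the combination of characters they define equals \<open>g_fun K q\<close>
  on the support. Pairing them with the exponential sums gives \<open>g_fun K q\<close> times the
  plain sum, and their squared norm is again \<open>g_fun K q\<close>; Cauchy-Schwarz
  concludes.\<close>

theorem exponential_sums_lower_bound:
  fixes b :: "int \<Rightarrow> real"
  assumes q: "q \<in> moduli Q"
    and supp: "\<And>n. n \<in> I \<Longrightarrow> b n \<noteq> 0 \<Longrightarrow> n mod int q \<in> K q"
  shows "g_fun K q \<ge> 0"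
    and "g_fun K q * (\<Sum>n\<in>I. b n)\<^sup>2 \<le>
         (\<Sum>a\<in>reduced_residues q. (norm (\<Sum>n\<in>I. of_real (b n) * additive_char (real a * (of_int n / real q))))\<^sup>2)"
proof -
  define k where "k = card (K q)"
  have k: "k > 0" using card_K_pos[OF q] by (simp add: k_def)
  define R where "R = reduced_residues q"
  define e where "e a n = additive_char (real a * (of_int n / real q))" for a :: nat and n :: int
  have e: "e a (m - n) = e a m * cnj (e a n)" for a m n
    by (simp add: e_def cnj_additive_char additive_char_add[symmetric] algebra_simps diff_divide_distrib)
  define c where "c a = (\<Sum>x\<in>K q. cnj (e a x)) / of_nat k" for a
  define S where "S a = (\<Sum>n\<in>I. of_real (b n) * e a n)" for a
  have key: "(\<Sum>a\<in>R. c a * e a n) = of_real (g_fun K q)" if "n mod int q \<in> K q" for n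
  proof -
    have "c a * e a n = (\<Sum>x\<in>K q. e a (n - x)) / of_nat k" for a
      by (simp add: c_def e sum_distrib_left mult.commute)
    then have "(\<Sum>a\<in>R. c a * e a n) = (\<Sum>a\<in>R. \<Sum>x\<in>K q. e a (n - x)) / of_nat k"
      by (simp add: sum_divide_distrib)
    also have "(\<Sum>a\<in>R. \<Sum>x\<in>K q. e a (n - x)) = (\<Sum>x\<in>K q. \<Sum>a\<in>R. e a (n - x))"
      by (rule sum.swap)
    also have "\<dots> / of_nat k = of_real (g_fun K q)"
      using average_ramanujan_sum_eq_g_fun[OF q that]
      by (simp add: ramanujan_sum_def R_def e_def k_def)
    finally show ?thesis .
  qed
  \<comment> \<open>Expanding one factor as an average over \<open>y\<close> in \<open>K q\<close>
    reduces the norm to an average of the constant in \<open>key\<close>.\<close>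
  have "of_real (\<Sum>a\<in>R. (norm (c a))\<^sup>2) = (\<Sum>a\<in>R. c a * cnj (c a))"
    by (simp only: of_real_sum complex_norm_square)
  also have "\<dots> = (\<Sum>y\<in>K q. \<Sum>a\<in>R. c a * e a y) / of_nat k"
    by (subst sum.swap) (simp add: c_def[of _] sum_divide_distrib sum_distrib_left)
  also have "\<dots> = (\<Sum>y\<in>K q. of_real (g_fun K q)) / of_nat k"
    using mod_K[OF q] by (intro arg_cong2[where f = "(/)"] sum.cong key refl) auto
  also have "\<dots> = of_real (g_fun K q)" using k by (simp add: k_def)
  finally have norm_c: "(\<Sum>a\<in>R. (norm (c a))\<^sup>2) = g_fun K q" by (simp only: of_real_eq_iff)
  show g0: "g_fun K q \<ge> 0" unfolding norm_c[symmetric] by (simp add: sum_nonneg)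
  have "(\<Sum>a\<in>R. c a * S a) = (\<Sum>n\<in>I. of_real (b n) * (\<Sum>a\<in>R. c a * e a n))"
    unfolding S_def sum_distrib_left by (subst sum.swap) (simp add: mult_ac)
  also have "\<dots> = (\<Sum>n\<in>I. of_real (b n) * of_real (g_fun K q))"
    by (rule sum.cong[OF refl]) (use key supp in force)
  also have "\<dots> = of_real (g_fun K q * (\<Sum>n\<in>I. b n))"
    by (simp add: sum_distrib_left mult.commute)
  finally have "\<bar>g_fun K q * (\<Sum>n\<in>I. b n)\<bar> = norm (\<Sum>a\<in>R. c a * S a)"
    by (simp only: norm_of_real)
  also have "\<dots> \<le> (\<Sum>a\<in>R. norm (c a) * norm (S a))"
    using norm_sum[of "\<lambda>a. c a * S a" R] by (simp add: norm_mult)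
  finally have "(g_fun K q * (\<Sum>n\<in>I. b n))\<^sup>2 \<le> (\<Sum>a\<in>R. norm (c a) * norm (S a))\<^sup>2"
    by (subst power2_abs[symmetric], intro power_mono) auto
  also have "\<dots> \<le> g_fun K q * (\<Sum>a\<in>R. (norm (S a))\<^sup>2)"
    unfolding norm_c[symmetric] by (rule Cauchy_Schwarz_ineq_sum)
  finally have *: "g_fun K q * (g_fun K q * (\<Sum>n\<in>I. b n)\<^sup>2) \<le> g_fun K q * (\<Sum>a\<in>R. (norm (S a))\<^sup>2)"
    by (simp add: power2_eq_square mult_ac)
  have "g_fun K q * (\<Sum>n\<in>I. b n)\<^sup>2 \<le> (\<Sum>a\<in>R. (norm (S a))\<^sup>2)"
  proof (cases "g_fun K q = 0")
    case True
    then show ?thesis by (simp add: sum_nonneg)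
  next
    case False
    with g0 * show ?thesis by (metis mult_le_cancel_left_pos order_le_less)
  qed
  then show "g_fun K q * (\<Sum>n\<in>I. b n)\<^sup>2 \<le>
      (\<Sum>a\<in>reduced_residues q. (norm (\<Sum>n\<in>I. of_real (b n) * additive_char (real a * (of_int n / real q))))\<^sup>2)"
    by (simp add: R_def S_def e_def)
qed

end

section \<open>The large sieve\<close>

lemma continuous_on_additive_char [continuous_intros]:
  "continuous_on S f \<Longrightarrow> continuous_on S (\<lambda>x. additive_char (f x))"
  unfolding additive_char_def by (intro continuous_intros)

lemma Re_additive_char: "Re (additive_char x) = cos (2 * pi * x)"
  by (simp add: additive_char_def)

lemma Cauchy_Schwarz_integral:
  fixes f g :: "real \<Rightarrow> complex"
  assumes f: "continuous_on {a..b} f" and g: "continuous_on {a..b} g"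
    and B: "integral {a..b} (\<lambda>t. (norm (g t))\<^sup>2) \<le> B" "B > 0"
  shows "(norm (integral {a..b} (\<lambda>t. f t * cnj (g t))))\<^sup>2 \<le> B * integral {a..b} (\<lambda>t. (norm (f t))\<^sup>2)"
proof -
  define S where "S = integral {a..b} (\<lambda>t. f t * cnj (g t))"
  define n where "n = integral {a..b} (\<lambda>t. (norm (g t))\<^sup>2)"
  define m where "m = integral {a..b} (\<lambda>t. (norm (f t))\<^sup>2)"
  \<comment> \<open>Nonnegativity of the integral of \<open>|f - k * g|^2\<close> gives the claim;
    dividing by the bound \<open>B\<close> rather than the exact norm also covers a vanishing
    \<open>g\<close>.\<close>
  define k where "k = S / of_real B"
  have hS: "((\<lambda>t. f t * cnj (g t)) has_integral S) {a..b}"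
    unfolding S_def using f g by (intro integrable_integral integrable_continuous_real continuous_intros)
  have hn: "((\<lambda>t. (norm (g t))\<^sup>2) has_integral n) {a..b}"
    unfolding n_def using g by (intro integrable_integral integrable_continuous_real continuous_intros)
  have hm: "((\<lambda>t. (norm (f t))\<^sup>2) has_integral m) {a..b}"
    unfolding m_def using f by (intro integrable_integral integrable_continuous_real continuous_intros)
  have "bounded_linear (\<lambda>z. Re (cnj k * z))"
    by (intro bounded_linear_compose[OF bounded_linear_Re] bounded_linear_mult_right)
  from has_integral_linear[OF hS this]
  have hR: "((\<lambda>t. Re (cnj k * (f t * cnj (g t)))) has_integral Re (cnj k * S)) {a..b}"
    by (simp add: o_def)
  have expand: "(norm (f t - k * g t))\<^sup>2 = (norm (f t))\<^sup>2 - 2 * Re (cnj k * (f t * cnj (g t))) + (norm k)\<^sup>2 * (norm (g t))\<^sup>2" for t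
    unfolding cmod_power2 by (simp add: power2_eq_square algebra_simps)
  have "((\<lambda>t. (norm (f t - k * g t))\<^sup>2) has_integral m - 2 * Re (cnj k * S) + (norm k)\<^sup>2 * n) {a..b}"
    unfolding expand by (intro has_integral_add has_integral_diff has_integral_mult_right hm hn hR)
  then have "0 \<le> m - 2 * Re (cnj k * S) + (norm k)\<^sup>2 * n"
    by (rule has_integral_nonneg) simp
  also have "\<dots> \<le> m - 2 * Re (cnj k * S) + (norm k)\<^sup>2 * B"
    using B(1) by (simp add: n_def mult_left_mono)
  also have "Re (cnj k * S) = (norm S)\<^sup>2 / B"
    unfolding cmod_power2 by (simp add: k_def power2_eq_square add_divide_distrib)
  also have "(norm k)\<^sup>2 * B = (norm S)\<^sup>2 / B"
    using B(2) by (simp add: k_def norm_divide power2_eq_square)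
  finally have "(norm S)\<^sup>2 / B \<le> m" by simp
  then show ?thesis
    using B(2) by (simp add: S_def m_def field_simps)
qed

lemma sum_integrals_nonoverlapping_le:
  fixes f :: "real \<Rightarrow> real"
  assumes "finite R" and f: "continuous_on {x..y} f" and nonneg: "\<And>t. 0 \<le> f t"
    and sub: "\<And>r. r \<in> R \<Longrightarrow> {a r..b r} \<subseteq> {x..y}"
    and disj: "\<And>r s. r \<in> R \<Longrightarrow> s \<in> R \<Longrightarrow> r \<noteq> s \<Longrightarrow> b r \<le> a s \<or> b s \<le> a r"
  shows "(\<Sum>r\<in>R. integral {a r..b r} f) \<le> integral {x..y} f"
proof -
  have "(f has_integral (\<Sum>r\<in>R. integral {a r..b r} f)) (\<Union>r\<in>R. {a r..b r})"
  proof (rule has_integral_UN[OF \<open>finite R\<close>])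
    show "(f has_integral integral {a r..b r} f) {a r..b r}" if "r \<in> R" for r
      using continuous_on_subset[OF f sub[OF that]] by (intro integrable_integral integrable_continuous_real)
    show "pairwise (\<lambda>r s. negligible ({a r..b r} \<inter> {a s..b s})) R"
    proof (rule pairwiseI)
      fix r s assume "r \<in> R" "s \<in> R" "r \<noteq> s"
      then have "{a r..b r} \<inter> {a s..b s} \<subseteq> {b r, b s}" using disj by fastforce
      then show "negligible ({a r..b r} \<inter> {a s..b s})"
        by (rule negligible_subset[rotated]) simp
    qed
  qed
  moreover have "(f has_integral integral {x..y} f) {x..y}"
    using f by (intro integrable_integral integrable_continuous_real)
  moreover have "(\<Union>r\<in>R. {a r..b r}) \<subseteq> {x..y}" using sub by blast
  ultimately show ?thesis
    using nonneg by (intro has_integral_subset_le[of _ "{x..y}" f]) auto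
qed

definition trig_poly :: "int set \<Rightarrow> (int \<Rightarrow> real) \<Rightarrow> real \<Rightarrow> complex" where
  "trig_poly I u t = (\<Sum>n\<in>I. of_real (u n) * additive_char (of_int n * t))"

lemma continuous_on_trig_poly [continuous_intros]:
  "continuous_on S f \<Longrightarrow> continuous_on S (\<lambda>x. trig_poly I u (f x))"
  unfolding trig_poly_def by (intro continuous_intros)

lemma integral_trig_poly_square:
  "integral {x..x + 1} (\<lambda>t. (norm (trig_poly I u t))\<^sup>2) = (\<Sum>n\<in>I. (u n)\<^sup>2)"
\<comment> \<open>Parseval's identity by expanding the square; for infinite \<open>I\<close> both
  sums default to 0.\<close>
proof (cases "finite I")
  case True
  have orth: "((\<lambda>t. cos (2 * pi * of_int k * t)) has_integral (if k = 0 then 1 else 0)) {x..x + 1}" for k :: int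
  proof (cases "k = 0")
    case True
    then show ?thesis using has_integral_const_real[of "1::real" x "x + 1"] by simp
  next
    case False
    have "((\<lambda>t. cos (2 * pi * of_int k * t)) has_integral
        sin (2 * pi * of_int k * (x + 1)) / (2 * pi * of_int k) - sin (2 * pi * of_int k * x) / (2 * pi * of_int k)) {x..x + 1}"
      using False
      by (intro fundamental_theorem_of_calculus)
         (auto intro!: derivative_eq_intros simp: has_real_derivative_iff_has_vector_derivative[symmetric])
    moreover have "sin (2 * pi * of_int k * (x + 1)) = sin (2 * pi * of_int k * x)"
      by (simp add: distrib_left sin_add)
    ultimately show ?thesis using False by simp
  qed
  have norm_eq: "(norm (trig_poly I u t))\<^sup>2 = (\<Sum>n\<in>I. \<Sum>m\<in>I. u n * u m * cos (2 * pi * of_int (n - m) * t))" for t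
  proof -
    have "of_real ((norm (trig_poly I u t))\<^sup>2) = trig_poly I u t * cnj (trig_poly I u t)"
      by (simp only: complex_norm_square)
    also have "\<dots> = (\<Sum>n\<in>I. \<Sum>m\<in>I. of_real (u n * u m) * additive_char (of_int (n - m) * t))"
      unfolding trig_poly_def cnj_sum sum_product
      by (intro sum.cong refl)
         (simp add: cnj_additive_char left_diff_distrib additive_char_add[of _ "- _", simplified])
    finally have "(norm (trig_poly I u t))\<^sup>2 = Re (\<Sum>n\<in>I. \<Sum>m\<in>I. of_real (u n * u m) * additive_char (of_int (n - m) * t))"
      by (metis Re_complex_of_real)
    then show ?thesis by (simp add: Re_additive_char mult.assoc)
  qed
  have "((\<lambda>t. (norm (trig_poly I u t))\<^sup>2) has_integral (\<Sum>n\<in>I. \<Sum>m\<in>I. u n * u m * (if n - m = 0 then 1 else 0))) {x..x + 1}"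
    unfolding norm_eq using True by (intro has_integral_sum has_integral_mult_right orth)
  also have "(\<Sum>n\<in>I. \<Sum>m\<in>I. u n * u m * (if n - m = 0 then 1 else 0)) = (\<Sum>n\<in>I. (u n)\<^sup>2)"
  proof (rule sum.cong[OF refl])
    fix n assume "n \<in> I"
    have "(\<Sum>m\<in>I. u n * u m * (if n - m = 0 then 1 else 0)) = (\<Sum>m\<in>I. if m = n then u n * u m else 0)"
      by (rule sum.cong) auto
    also have "\<dots> = (u n)\<^sup>2" using True \<open>n \<in> I\<close> by (simp add: power2_eq_square)
    finally show "(\<Sum>m\<in>I. u n * u m * (if n - m = 0 then 1 else 0)) = (u n)\<^sup>2" .
  qed
  finally show ?thesis by (rule integral_unique)
qed (simp add: trig_poly_def)

text \<open>The integrand at \<open>- s\<close> is the conjugate of that at \<open>s\<close>, so the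
  two halves add up to twice a real part.\<close>

lemma has_integral_even_char:
  assumes h: "continuous_on {0..1} h"
  shows "((\<lambda>s. of_real (h \<bar>s\<bar>) * additive_char (x * s)) has_integral
           of_real (2 * integral {0..1} (\<lambda>s. h s * cos (2 * pi * x * s)))) {-1..1}"
proof -
  define f where "f s = of_real (h \<bar>s\<bar>) * additive_char (x * s)" for s
  define Z where "Z = integral {0..1} f"
  have ca: "continuous_on {0..1::real} (\<lambda>s. h \<bar>s\<bar>)"
    by (rule continuous_on_eq[OF h]) simp
  have f: "(f has_integral Z) {0..1}"
    unfolding Z_def f_def using ca by (intro integrable_integral integrable_continuous_real continuous_intros)
  have fm: "f (- s) = cnj (f s)" for s by (simp add: f_def cnj_additive_char)
  have "((\<lambda>s. cnj (f s)) has_integral cnj Z) {0..1}"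
    using f has_integral_cnj[of f Z] by (simp add: o_def)
  then have "((\<lambda>s. f (- s)) has_integral cnj Z) {0..1}" by (simp only: fm)
  then have "(f has_integral cnj Z) {-1..0}"
    using has_integral_reflect_real[of f "cnj Z" 0 "-1"] by simp
  then have "(f has_integral (cnj Z + Z)) {-1..1}"
    using f by (intro has_integral_combine[of "-1" 0 1]) auto
  moreover have "cnj Z + Z = of_real (2 * Re Z)" by (simp add: complex_eq_iff)
  moreover have "((\<lambda>s. Re (f s)) has_integral Re Z) {0..1}"
    using has_integral_linear[OF f bounded_linear_Re] by (simp add: o_def)
  then have "((\<lambda>s. h s * cos (2 * pi * x * s)) has_integral Re Z) {0..1}"
    by (rule has_integral_eq[rotated]) (simp add: f_def Re_additive_char mult.assoc)
  then have "Re Z = integral {0..1} (\<lambda>s. h s * cos (2 * pi * x * s))" by (simp add: integral_unique)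
  ultimately show ?thesis by (simp add: f_def[abs_def])
qed

text \<open>The Fourier transform of the even extension of \<open>phi l\<close>: the
  Beurling-Selberg majorant of the interval from \<open>- l / 2\<close> to
  \<open>l / 2\<close>.\<close>

definition arc_weight :: "real \<Rightarrow> real \<Rightarrow> real" where
  "arc_weight l x = 2 * integral {0..1} (\<lambda>v. phi l v * cos (2 * pi * x * v))"

text \<open>After rescaling the arc to the interval from -1 to 1, Cauchy-Schwarz is applied against
  \<open>phi l\<close> modulated by frequency \<open>\<nu>\<close>. The pairing turns
  \<open>u n\<close> into \<open>u n\<close> times the majorant at \<open>(n - \<nu>) / T\<close>;
  the norm is bounded by \<open>phi_norm_le\<close>.\<close>

lemma arc_lower_bound:
  assumes T: "T > 0" and l: "l > 0"
  shows "(norm (\<Sum>n\<in>I. of_real (u n * arc_weight l ((of_int n - \<nu>) / T)) * additive_char (\<alpha> * of_int n)))\<^sup>2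
    \<le> T * (l + c_const) * integral {\<alpha> - 1 / T..\<alpha> + 1 / T} (\<lambda>t. (norm (trig_poly I u t))\<^sup>2)"
proof (cases "finite I")
  case True
  define P where "P s = trig_poly I u (1 / T * s + \<alpha>)" for s
  define w where "w s = of_real (phi l \<bar>s\<bar>) * additive_char (\<nu> * (s / T + \<alpha>))" for s
  have cphi: "continuous_on {-1..1::real} (\<lambda>s. phi l \<bar>s\<bar>)"
    by (rule continuous_on_compose2[OF continuous_on_phi]) (auto intro!: continuous_intros)
  have cw: "continuous_on {-1..1} w"
    unfolding w_def using T cphi by (intro continuous_intros) auto
  have cP: "continuous_on {-1..1} P"
    unfolding P_def by (intro continuous_intros)
  have "((\<lambda>s. of_real ((phi l \<bar>s\<bar>)\<^sup>2) * additive_char (0 * s)) has_integral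
      of_real (2 * integral {0..1} (\<lambda>s. (phi l s)\<^sup>2 * cos (2 * pi * 0 * s)))) {-1..1}"
    by (rule has_integral_even_char) (intro continuous_intros continuous_on_phi)
  from has_integral_linear[OF this bounded_linear_Re]
  have "((\<lambda>s. (norm (w s))\<^sup>2) has_integral phi_norm l) {-1..1}"
    by (simp add: o_def w_def norm_mult phi_norm_def)
  then have norm_w: "integral {-1..1} (\<lambda>s. (norm (w s))\<^sup>2) \<le> l + c_const"
    using phi_norm_le[OF l] by (simp add: integral_unique)
  have "((\<lambda>s. P s * cnj (w s)) has_integral
      (\<Sum>n\<in>I. of_real (u n) * additive_char ((of_int n - \<nu>) * \<alpha>) *
        of_real (2 * integral {0..1} (\<lambda>v. phi l v * cos (2 * pi * ((of_int n - \<nu>) / T) * v))))) {-1..1}"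
  proof -
    have "P s * cnj (w s) = (\<Sum>n\<in>I. of_real (u n) * additive_char ((of_int n - \<nu>) * \<alpha>) *
        (of_real (phi l \<bar>s\<bar>) * additive_char ((of_int n - \<nu>) / T * s)))" for s
      unfolding P_def w_def trig_poly_def sum_distrib_right
    proof (rule sum.cong[OF refl])
      fix n
      have "additive_char (of_int n * (1 / T * s + \<alpha>)) * additive_char (- (\<nu> * (s / T + \<alpha>))) =
          additive_char ((of_int n - \<nu>) * \<alpha>) * additive_char ((of_int n - \<nu>) / T * s)"
        unfolding additive_char_add[symmetric] using T
        by (intro arg_cong[where f = additive_char]) (simp add: field_simps)
      then show "of_real (u n) * additive_char (of_int n * (1 / T * s + \<alpha>)) *
          cnj (of_real (phi l \<bar>s\<bar>) * additive_char (\<nu> * (s / T + \<alpha>))) =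
          of_real (u n) * additive_char ((of_int n - \<nu>) * \<alpha>) *
          (of_real (phi l \<bar>s\<bar>) * additive_char ((of_int n - \<nu>) / T * s))"
        by (simp add: cnj_additive_char mult_ac)
    qed
    note eq = this
    show ?thesis
      unfolding eq by (intro has_integral_sum[OF True] has_integral_mult_right has_integral_even_char continuous_on_phi)
  qed
  \<comment> \<open>The centring costs only the unimodular factor
    \<open>additive_char (- (\<nu> * \<alpha>))\<close>, which the norm ignores.\<close>
  also have "(\<Sum>n\<in>I. of_real (u n) * additive_char ((of_int n - \<nu>) * \<alpha>) *
        of_real (2 * integral {0..1} (\<lambda>v. phi l v * cos (2 * pi * ((of_int n - \<nu>) / T) * v)))) =
      additive_char (- (\<nu> * \<alpha>)) * (\<Sum>n\<in>I. of_real (u n * arc_weight l ((of_int n - \<nu>) / T)) * additive_char (\<alpha> * of_int n))"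
    unfolding sum_distrib_left arc_weight_def
  proof (rule sum.cong[OF refl])
    fix n
    have "additive_char ((of_int n - \<nu>) * \<alpha>) = additive_char (- (\<nu> * \<alpha>)) * additive_char (\<alpha> * of_int n)"
      unfolding additive_char_add[symmetric] by (simp add: algebra_simps)
    then show "of_real (u n) * additive_char ((of_int n - \<nu>) * \<alpha>) *
        of_real (2 * integral {0..1} (\<lambda>v. phi l v * cos (2 * pi * ((of_int n - \<nu>) / T) * v))) =
      additive_char (- (\<nu> * \<alpha>)) * (of_real (u n * (2 * integral {0..1} (\<lambda>v. phi l v * cos (2 * pi * ((of_int n - \<nu>) / T) * v)))) *
        additive_char (\<alpha> * of_int n))"
      by (simp add: mult_ac)
  qed
  finally have S: "norm (integral {-1..1} (\<lambda>s. P s * cnj (w s))) =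
      norm (\<Sum>n\<in>I. of_real (u n * arc_weight l ((of_int n - \<nu>) / T)) * additive_char (\<alpha> * of_int n))"
    by (simp add: integral_unique norm_mult)
  have "((\<lambda>t. (norm (trig_poly I u t))\<^sup>2) has_integral
      integral {\<alpha> - 1 / T..\<alpha> + 1 / T} (\<lambda>t. (norm (trig_poly I u t))\<^sup>2)) (cbox (\<alpha> - 1 / T) (\<alpha> + 1 / T))"
    by (simp add: integrable_integral integrable_continuous_real continuous_intros)
  from has_integral_affinity'[OF this, of "1 / T" \<alpha>]
  have "integral {-1..1} (\<lambda>s. (norm (P s))\<^sup>2) =
      T * integral {\<alpha> - 1 / T..\<alpha> + 1 / T} (\<lambda>t. (norm (trig_poly I u t))\<^sup>2)"
    using T by (simp add: P_def integral_unique)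
  with Cauchy_Schwarz_integral[OF cP cw norm_w] S l c_const_nonneg show ?thesis
    by (simp add: mult_ac)
qed (use T l c_const_nonneg in \<open>simp add: trig_poly_def\<close>)

text \<open>Distinct reduced fractions are at least \<open>1 / (q * q')\<close> apart, and the
  half-lengths of their arcs add up to at most that.\<close>

lemma reduced_fraction_arcs_disjoint:
  fixes Q :: real
  assumes q: "q \<in> moduli Q" "q' \<in> moduli Q"
    and a: "a \<in> reduced_residues q" "a' \<in> reduced_residues q'" and ne: "(q, a) \<noteq> (q', a')"
  defines "\<delta> \<equiv> \<lambda>q. 1 / (real q * (real q + Q))"
  shows "\<delta> q + \<delta> q' \<le> 1 / (real q * real q')"
    and "real a / real q + \<delta> q \<le> real a' / real q' - \<delta> q' \<or>
         real a' / real q' + \<delta> q' \<le> real a / real q - \<delta> q"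
proof -
  define x where "x = real q"
  define y where "y = real q'"
  have xy: "x > 0" "y > 0" "x \<le> Q" "y \<le> Q" using q by (auto simp: moduli_def x_def y_def)
  \<comment> \<open>Clearing denominators, this is the claim on the half-lengths. The smaller of
    \<open>x\<close> and \<open>y\<close> has square at most \<open>x * y\<close>, the larger at
    most \<open>Q * Q\<close>.\<close>
  have "x * x + y * y \<le> x * y + Q * Q"
  proof (cases "x \<le> y")
    case True
    then have "x * x \<le> x * y" "y * y \<le> Q * Q" using xy by (auto intro!: mult_mono)
    then show ?thesis by simp
  next
    case False
    then have "y * y \<le> x * y" "x * x \<le> Q * Q" using xy by (auto intro!: mult_mono)
    then show ?thesis by simp
  qed
  then have "(y * (y + Q) + x * (x + Q)) / (x * y * ((x + Q) * (y + Q))) \<le> ((x + Q) * (y + Q)) / (x * y * ((x + Q) * (y + Q)))"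
    using xy by (intro divide_right_mono) (simp_all add: algebra_simps)
  moreover have "\<delta> q + \<delta> q' = (y * (y + Q) + x * (x + Q)) / (x * y * ((x + Q) * (y + Q)))"
  proof -
    have "x + Q \<noteq> 0" "y + Q \<noteq> 0" using xy by auto
    then show ?thesis
      unfolding \<delta>_def x_def[symmetric] y_def[symmetric] using xy by (simp add: divide_simps)
  qed
  ultimately show le: "\<delta> q + \<delta> q' \<le> 1 / (real q * real q')"
    using xy by (simp add: x_def y_def)
  have "a * q' \<noteq> a' * q"
    using a ne coprime_crossproduct_nat[of a q a' q'] by (auto simp: reduced_residues_def coprime_commute)
  then have "\<bar>int a * int q' - int a' * int q\<bar> \<ge> 1"
    by (metis eq_iff_diff_eq_0 int_one_le_iff_zero_less of_nat_eq_iff of_nat_mult zero_less_abs_iff)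
  then have "1 \<le> real_of_int \<bar>int a * int q' - int a' * int q\<bar>" by (simp only: of_int_1_le_iff)
  then have "\<bar>real a * y - real a' * x\<bar> \<ge> 1" by (simp add: x_def y_def)
  then have "\<bar>real a * y - real a' * x\<bar> / (x * y) \<ge> 1 / (x * y)"
    using xy by (intro divide_right_mono) auto
  also have "\<bar>real a * y - real a' * x\<bar> / (x * y) = \<bar>real a / x - real a' / y\<bar>"
  proof -
    have "real a / x - real a' / y = (real a * y - real a' * x) / (x * y)"
      using xy by (simp add: field_simps)
    then show ?thesis using xy by (simp add: abs_mult)
  qed
  finally have "\<delta> q + \<delta> q' \<le> \<bar>real a / real q - real a' / real q'\<bar>"
    using le by (simp add: x_def y_def)
  then show "real a / real q + \<delta> q \<le> real a' / real q' - \<delta> q' \<or>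
         real a' / real q' + \<delta> q' \<le> real a / real q - \<delta> q"
    by linarith
qed

theorem theorem1p3:
  fixes M :: int and N :: nat and Q :: real
    and K :: "nat \<Rightarrow> int set" and u :: "int \<Rightarrow> real"
  assumes "N \<ge> 1" and "Q \<ge> 1"
    and "residue_sequence Q K"
    and "multiplicative_sequence Q K"
    and "consistent_sequence Q K"
    and "johnsen_gallagher Q K"
    and "\<And>n. n \<in> {M<..M + int N} \<Longrightarrow> u n \<ge> 0"
    and "has_support M N u Q K"
  shows "\<bar>\<Sum>n \<in> {M<..M + int N}. u n\<bar>\<^sup>2
           \<le> 1 / L_fun K N Q * (\<Sum>n \<in> {M<..M + int N}. (u n)\<^sup>2)"
proof -
  interpret sieve_sequence Q K
    using assms by unfold_locales
  define I where "I = {M<..M + int N}"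
  define Z where "Z = (\<Sum>n\<in>I. u n)"
  define \<delta> where "\<delta> q = 1 / (real q * (real q + Q))" for q
  define f where "f t = (norm (trig_poly I u t))\<^sup>2" for t
  define R where "R = Sigma (moduli Q) reduced_residues"
  define \<alpha> where "\<alpha> = (\<lambda>(q, a). real a / real q)"
  define W where "W q = real N + c_const * real q * (real q + Q)" for q
  have cf: "continuous_on S f" for S unfolding f_def by (intro continuous_intros)
  have one: "1 \<in> moduli Q" "0 \<in> reduced_residues 1"
    using \<open>Q \<ge> 1\<close> by (auto simp: moduli_def reduced_residues_def)
  have "moduli Q \<subseteq> {..nat \<lfloor>Q\<rfloor>}"
    by (auto simp: moduli_def le_nat_floor)
  then have fin: "finite (moduli Q)" by (rule finite_subset) simp
  have W: "W q > 0" if "q \<in> moduli Q" for q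
    using that \<open>N \<ge> 1\<close> \<open>Q \<ge> 1\<close> c_const_nonneg by (auto simp: W_def intro!: add_pos_nonneg)
  have g0: "g_fun K q \<ge> 0" if "q \<in> moduli Q" for q
    using exponential_sums_lower_bound(1)[OF that, of "{}"] by simp

  \<comment> \<open>The contribution of one modulus\<close>
  have step: "g_fun K q / W q * Z\<^sup>2 \<le> (\<Sum>a\<in>reduced_residues q. integral {\<alpha> (q, a) - \<delta> q..\<alpha> (q, a) + \<delta> q} f)"
    if q: "q \<in> moduli Q" for q
  proof -
    \<comment> \<open>\<open>1 / T\<close> is the half-length of the arcs, \<open>l\<close> the
      length of the rescaled summation interval and \<open>\<nu>\<close> its midpoint before
      rescaling; \<open>T * (l + c_const)\<close> is then the denominator
      \<open>W q\<close>.\<close>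
    define T where "T = real q * (real q + Q)"
    define l where "l = real N / T"
    define \<nu> where "\<nu> = of_int M + real N / 2"
    define b where "b n = u n * arc_weight l ((of_int n - \<nu>) / T)" for n
    have T: "T > 0" using moduli_pos[OF q] \<open>Q \<ge> 1\<close> by (simp add: T_def)
    have l: "l > 0" using T \<open>N \<ge> 1\<close> by (simp add: l_def)
    have "T * (l + c_const) = real N + c_const * T"
      using T by (simp add: l_def field_simps)
    then have W_eq: "T * (l + c_const) = W q"
      by (simp add: W_def T_def mult.assoc)
    have "u n \<le> b n" if "n \<in> I" for n
    proof -
      have "\<bar>of_int n - \<nu>\<bar> \<le> real N / 2"
        using that unfolding I_def \<nu>_def abs_le_iff by auto
      then have "2 * \<bar>of_int n - \<nu>\<bar> / T \<le> l"
        using T unfolding l_def by (intro divide_right_mono) auto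
      then have "\<bar>2 * ((of_int n - \<nu>) / T)\<bar> \<le> l"
        using T unfolding abs_mult abs_divide by simp
      then have "1 \<le> arc_weight l ((of_int n - \<nu>) / T)"
        unfolding arc_weight_def by (rule integral_phi_cos_ge)
      moreover have "u n \<ge> 0" using assms(7) that by (simp add: I_def)
      ultimately show ?thesis by (simp add: b_def mult_le_cancel_left1)
    qed
    then have "Z \<le> (\<Sum>n\<in>I. b n)" unfolding Z_def by (rule sum_mono)
    \<comment> \<open>Since \<open>u\<close> is nonnegative, the weights can only increase the sum,
      and the comparison survives squaring.\<close>
    moreover have "0 \<le> Z" unfolding Z_def using assms(7) by (auto simp: I_def intro: sum_nonneg)
    ultimately have "g_fun K q * Z\<^sup>2 \<le> g_fun K q * (\<Sum>n\<in>I. b n)\<^sup>2"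
      using g0[OF q] by (intro mult_left_mono power_mono)
    also have "\<dots> \<le> (\<Sum>a\<in>reduced_residues q.
        (norm (\<Sum>n\<in>I. of_real (b n) * additive_char (real a * (of_int n / real q))))\<^sup>2)"
    proof (rule exponential_sums_lower_bound(2)[OF q])
      show "n mod int q \<in> K q" if "n \<in> I" "b n \<noteq> 0" for n
        using \<open>has_support M N u Q K\<close> that q by (auto simp: has_support_def I_def b_def)
    qed
    also have "\<dots> \<le> (\<Sum>a\<in>reduced_residues q. W q * integral {\<alpha> (q, a) - \<delta> q..\<alpha> (q, a) + \<delta> q} f)"
    proof (rule sum_mono)
      fix a
      show "(norm (\<Sum>n\<in>I. of_real (b n) * additive_char (real a * (of_int n / real q))))\<^sup>2
          \<le> W q * integral {\<alpha> (q, a) - \<delta> q..\<alpha> (q, a) + \<delta> q} f"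
        using arc_lower_bound[OF T l, where u = u and \<nu> = \<nu> and I = I and \<alpha> = "real a / real q"]
        unfolding W_eq unfolding b_def f_def[abs_def] \<delta>_def \<alpha>_def T_def by simp
    qed
    finally show ?thesis
      using W[OF q] by (simp add: sum_distrib_left[symmetric] field_simps)
  qed

  \<comment> \<open>Summation over all arcs\<close>
  have "L_fun K N Q * Z\<^sup>2 = (\<Sum>q\<in>moduli Q. g_fun K q / W q * Z\<^sup>2)"
    by (simp add: L_fun_def W_def sum_distrib_right)
  also have "\<dots> \<le> (\<Sum>q\<in>moduli Q. \<Sum>a\<in>reduced_residues q. integral {\<alpha> (q, a) - \<delta> q..\<alpha> (q, a) + \<delta> q} f)"
    by (rule sum_mono[OF step])
  also have "\<dots> = (\<Sum>r\<in>R. integral {\<alpha> r - \<delta> (fst r)..\<alpha> r + \<delta> (fst r)} f)"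
    unfolding R_def using fin by (subst sum.Sigma) (auto simp: case_prod_beta)
  \<comment> \<open>The period begins at the left end of the arc around 0, so no arc is cut modulo
    1; the others end by \<open>1 - \<delta> 1\<close>, as \<open>\<delta> q + \<delta> 1\<close> is
    at most \<open>1 / q\<close>.\<close>
  also have "\<dots> \<le> integral {- \<delta> 1..- \<delta> 1 + 1} f"
  proof (rule sum_integrals_nonoverlapping_le)
    show "finite R" unfolding R_def using fin by (rule finite_SigmaI) simp
    show "0 \<le> f t" for t by (simp add: f_def)
    show "\<alpha> r + \<delta> (fst r) \<le> \<alpha> s - \<delta> (fst s) \<or> \<alpha> s + \<delta> (fst s) \<le> \<alpha> r - \<delta> (fst r)"
      if "r \<in> R" "s \<in> R" "r \<noteq> s" for r s
      using reduced_fraction_arcs_disjoint(2)[of "fst r" Q "fst s" "snd r" "snd s"] that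
      by (auto simp: R_def \<alpha>_def \<delta>_def)
    show "{\<alpha> r - \<delta> (fst r)..\<alpha> r + \<delta> (fst r)} \<subseteq> {- \<delta> 1..- \<delta> 1 + 1}" if mem: "r \<in> R" for r
    proof -
      obtain q a where r: "r = (q, a)" and q: "q \<in> moduli Q" and a: "a \<in> reduced_residues q"
        using mem by (auto simp: R_def)
      have pos: "real q > 0" using moduli_pos[OF q] by simp
      show ?thesis
      proof (cases "q = 1")
        case True
        then have "a = 0" using a by (simp add: reduced_residues_def)
        moreover have "\<delta> 1 \<le> 1 / 2" using \<open>Q \<ge> 1\<close> by (simp add: \<delta>_def field_simps)
        ultimately show ?thesis by (simp add: r \<alpha>_def True)
      next
        case False
        have le: "\<delta> q + \<delta> 1 \<le> 1 / real q"
          using reduced_fraction_arcs_disjoint(1)[OF q one(1) a one(2)] False by (simp add: \<delta>_def)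
        have "1 \<le> a" "a + 1 \<le> q" using a False by (auto simp: reduced_residues_def Suc_le_eq intro: Nat.gr0I)
        then have "1 / real q \<le> real a / real q" "(real a + 1) / real q \<le> 1"
          using pos by (auto simp: divide_simps)
        then have "1 / real q \<le> \<alpha> r" "\<alpha> r + 1 / real q \<le> 1"
          by (auto simp: r \<alpha>_def add_divide_distrib)
        moreover have "0 \<le> \<delta> 1" using \<open>Q \<ge> 1\<close> by (simp add: \<delta>_def)
        ultimately show ?thesis using le by (auto simp: r)
      qed
    qed
  qed (rule cf)
  also have "\<dots> = (\<Sum>n\<in>I. (u n)\<^sup>2)"
    unfolding f_def by (rule integral_trig_poly_square)
  finally have main: "L_fun K N Q * Z\<^sup>2 \<le> (\<Sum>n\<in>I. (u n)\<^sup>2)" .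

  \<comment> \<open>Division by \<open>L_fun K N Q\<close> is legitimate because the modulus 1
    contributes a positive term: \<open>g_fun K 1\<close> is an empty product.\<close>
  have "0 < g_fun K 1 / W 1" using W[OF one(1)] by (simp add: g_fun_def)
  also have "\<dots> \<le> (\<Sum>q\<in>moduli Q. g_fun K q / W q)"
    using fin one(1) g0 W by (intro member_le_sum) (auto intro!: divide_nonneg_pos)
  finally have "0 < L_fun K N Q" by (simp add: L_fun_def W_def)
  with main show ?thesis
    by (simp add: Z_def I_def field_simps)
qed

end
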